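(* Let $X$ be a separable Banach space with the bounded approximation property and let $M$ be a norming subspace of $X^*$. Let $\phi:X^{**}\to X^{**}/M^{\perp}=M^*$ be the natural quotient mapping. Then $M$ is quasibasic if and only if for every sequence $(X(1,i),X(2,i))_{i=1}^\infty$ of pairs of subspaces of $X$ that is uniformly approximable in $X$, the sequence $(\phi(X(1,i)),\phi(X(2,i)))_{i=1}^\infty$ is uniformly approximable in $M^*$.
   Context: A Banach space $X$ is identified with its canonical image in $X^{**}$. A subspace $M\subset X^*$ is norming if there exists $c>0$ such that $\sup_{0\ne f\in M}|f(x)|/\|f\|\ge c\|x\|$ for all $x\in X$. A subspace $M\subset X^*$ is quasibasic if there exists a sequence of continuous finite-dimensional (i.e. finite-rank) linear operators $v_n:X\to X$ ($n\in\mathbb{N}$) such that $\lim_{n\to\infty}\|v_n(x)-x\|=0$ for all $x\in X$, and $\mathrm{im}(v_n^* )\subset M$ for all $n$, where $v_n^*:X^*\to X^*$ is the adjoint of $v_n$. For $M\subset X^*$, $M^\perp=\{x^{**}\in X^{**}: x^{**}(x^* )=0\ \forall x^*\in M\}$; the space $X^{**}/M^\perp$ is naturally isometric to $M^*$ (via restriction of functionals to $M$), and the two are identified. If $M$ is norming, $\phi|_X$ is an isomorphic embedding. Let $Z$ be a Banach space and let $Z(1)\subset Z(2)\subset Z$ be finite-dimensional subspaces. For $\lambda>0$ the pair $(Z(1),Z(2))$ is $\lambda$-approximable (in $Z$) if there exists a continuous linear operator $u:Z\to Z(2)$ with $\|u\|\le\lambda$ and $u|_{Z(1)}=I_{Z(1)}$.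 A sequence $(Z(1,i),Z(2,i))_{i=1}^\infty$ of pairs of such subspaces of $Z$ is uniformly approximable (in $Z$) if there exists $0<\lambda<\infty$ such that all pairs $(Z(1,i),Z(2,i))$ are $\lambda$-approximable. *)

theory Defs
  imports "HOL-Analysis.Analysis" "HOL-Library.Function_Algebras"
begin

text \<open>
  Real-valued functions form a real vector space under the pointwise operations.  This provides
  an ambient vector space for the dual of a subspace \<open>M\<close>, where \<open>M\<close> is a set and not a type.
\<close>

instantiation "fun" :: (type, real_vector) real_vector
begin

definition scaleR_fun :: "real \<Rightarrow> ('a \<Rightarrow> 'b) \<Rightarrow> 'a \<Rightarrow> 'b"
  where "scaleR_fun r f = (\<lambda>x. r *\<^sub>R f x)"

instance
  by standard (simp_all add: scaleR_fun_def fun_eq_iff scaleR_add_right scaleR_add_left)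

end

definition finite_dim_subspace :: "'z::real_vector set \<Rightarrow> bool"
  where "finite_dim_subspace S \<longleftrightarrow> (\<exists>B. finite B \<and> span B = S)"

definition finite_rank :: "('a::real_normed_vector \<Rightarrow>\<^sub>L 'b::real_normed_vector) \<Rightarrow> bool"
  where "finite_rank v \<longleftrightarrow> finite_dim_subspace (range (blinfun_apply v))"

definition bounded_approximation_property :: "'a::real_normed_vector itself \<Rightarrow> bool"
  where "bounded_approximation_property _ \<longleftrightarrow>
    (\<exists>l>0. \<forall>K::'a set. compact K \<longrightarrow> (\<forall>e>0. \<exists>T::'a \<Rightarrow>\<^sub>L 'a.
      finite_rank T \<and> norm T \<le> l \<and> (\<forall>x\<in>K. norm (blinfun_apply T x - x) \<le> e)))"

lift_definition adjoint_op ::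
  "('a::real_normed_vector \<Rightarrow>\<^sub>L 'a) \<Rightarrow> ('a \<Rightarrow>\<^sub>L real) \<Rightarrow>\<^sub>L ('a \<Rightarrow>\<^sub>L real)"
  is "\<lambda>v f. f o\<^sub>L v"
  by (rule bounded_bilinear.bounded_linear_left[OF bounded_bilinear_blinfun_compose])

lift_definition canonical_embedding ::
  "'a::real_normed_vector \<Rightarrow> (('a \<Rightarrow>\<^sub>L real) \<Rightarrow>\<^sub>L real)"
  is "\<lambda>x f. blinfun_apply f x"
  by (rule blinfun.bounded_linear_left)

text \<open>
  In the following supremum the functional \<open>f = 0\<close> contributes \<open>0 / 0 = 0\<close>.  So including it does
  not change the supremum of the nonnegative quotients, and it gives the value \<open>0\<close> for \<open>M = {0}\<close>.
  The quotients are bounded by \<open>norm x\<close>.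
\<close>

definition norming :: "('a::real_normed_vector \<Rightarrow>\<^sub>L real) set \<Rightarrow> bool"
  where "norming M \<longleftrightarrow> subspace M \<and>
    (\<exists>c>0. \<forall>x. (SUP f\<in>M. \<bar>blinfun_apply f x\<bar> / norm f) \<ge> c * norm x)"

definition quasibasic :: "('a::real_normed_vector \<Rightarrow>\<^sub>L real) set \<Rightarrow> bool"
  where "quasibasic M \<longleftrightarrow> subspace M \<and>
    (\<exists>v :: nat \<Rightarrow> 'a \<Rightarrow>\<^sub>L 'a.
      (\<forall>n. finite_rank (v n)) \<and>
      (\<forall>x. (\<lambda>n. norm (blinfun_apply (v n) x - x)) \<longlonglongrightarrow> 0) \<and>
      (\<forall>n. range (blinfun_apply (adjoint_op (v n))) \<subseteq> M))"

text \<open>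
  The dual of a subspace \<open>M\<close>: the bounded linear functionals on \<open>M\<close>, represented by functions that
  vanish outside \<open>M\<close> so that equality of functions is equality of functionals on \<open>M\<close>.
  The norm is the operator norm; as in \<open>onorm\<close>, the zero vector contributes \<open>0 / 0 = 0\<close>.
\<close>

definition subspace_dual :: "'b::real_normed_vector set \<Rightarrow> ('b \<Rightarrow> real) set"
  where "subspace_dual M = {g.
    (\<forall>f\<in>M. \<forall>h\<in>M. g (f + h) = g f + g h) \<and>
    (\<forall>r. \<forall>f\<in>M. g (r *\<^sub>R f) = r * g f) \<and>
    (\<exists>K. \<forall>f\<in>M. \<bar>g f\<bar> \<le> K * norm f) \<and>
    (\<forall>f. f \<notin> M \<longrightarrow> g f = 0)}"

definition subspace_dual_norm :: "'b::real_normed_vector set \<Rightarrow> ('b \<Rightarrow> real) \<Rightarrow> real"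
  where "subspace_dual_norm M g = (SUP f\<in>M. \<bar>g f\<bar> / norm f)"

definition annihilator ::
  "('a::real_normed_vector \<Rightarrow>\<^sub>L real) set \<Rightarrow> (('a \<Rightarrow>\<^sub>L real) \<Rightarrow>\<^sub>L real) set"
  where "annihilator M = {F. \<forall>f\<in>M. blinfun_apply F f = 0}"

text \<open>
  The natural quotient map from the bidual onto its quotient by \<open>annihilator M\<close>, with that quotient
  identified with the dual of \<open>M\<close>: a coset corresponds to the common restriction of its members
  to \<open>M\<close>.
\<close>

definition quotient_map_dual ::
  "('a::real_normed_vector \<Rightarrow>\<^sub>L real) set \<Rightarrow> (('a \<Rightarrow>\<^sub>L real) \<Rightarrow>\<^sub>L real) \<Rightarrow> ('a \<Rightarrow>\<^sub>L real) \<Rightarrow> real"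
  where "quotient_map_dual M F = (\<lambda>f. if f \<in> M then blinfun_apply F f else 0)"

lemma quotient_map_dual_eq_iff:
  "quotient_map_dual M F = quotient_map_dual M G \<longleftrightarrow> F - G \<in> annihilator M"
  by (auto simp: quotient_map_dual_def annihilator_def fun_eq_iff blinfun.diff_left)

lemma quotient_map_dual_in_dual:
  assumes "subspace M"
  shows "quotient_map_dual M F \<in> subspace_dual M"
proof -
  have "\<exists>K. \<forall>f\<in>M. \<bar>blinfun_apply F f\<bar> \<le> K * norm f"
    using norm_blinfun[of F] by (metis real_norm_def)
  then show ?thesis
    using assms unfolding subspace_dual_def quotient_map_dual_def
    by (auto simp: subspace_add subspace_scale blinfun.add_right blinfun.scaleR_right)
qed

text \<open>
  Approximability of a pair in a normed space given by a linear subspace \<open>Z\<close> of an ambient vector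
  space and a norm \<open>N\<close> on \<open>Z\<close>.  Only the values of \<open>u\<close> on \<open>Z\<close> matter; the last but one condition
  expresses that the operator norm of \<open>u\<close> is at most \<open>l\<close>.
\<close>

definition approximable ::
  "'z::real_vector set \<Rightarrow> ('z \<Rightarrow> real) \<Rightarrow> real \<Rightarrow> 'z set \<Rightarrow> 'z set \<Rightarrow> bool"
  where "approximable Z N l Z1 Z2 \<longleftrightarrow>
    finite_dim_subspace Z1 \<and> finite_dim_subspace Z2 \<and> Z1 \<subseteq> Z2 \<and> Z2 \<subseteq> Z \<and>
    (\<exists>u :: 'z \<Rightarrow> 'z.
      (\<forall>x\<in>Z. \<forall>y\<in>Z. u (x + y) = u x + u y) \<and>
      (\<forall>r. \<forall>x\<in>Z. u (r *\<^sub>R x) = r *\<^sub>R u x) \<and>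
      u ` Z \<subseteq> Z2 \<and>
      (\<forall>x\<in>Z. N (u x) \<le> l * N x) \<and>
      (\<forall>x\<in>Z1. u x = x))"

definition uniformly_approximable ::
  "'z::real_vector set \<Rightarrow> ('z \<Rightarrow> real) \<Rightarrow> (nat \<Rightarrow> 'z set) \<Rightarrow> (nat \<Rightarrow> 'z set) \<Rightarrow> bool"
  where "uniformly_approximable Z N Z1 Z2 \<longleftrightarrow> (\<exists>l>0. \<forall>i. approximable Z N l (Z1 i) (Z2 i))"

lemma approximable_UNIV_iff:
  fixes Z1 Z2 :: "'z::real_normed_vector set"
  assumes "l > 0"
  shows "approximable UNIV norm l Z1 Z2 \<longleftrightarrow>
    finite_dim_subspace Z1 \<and> finite_dim_subspace Z2 \<and> Z1 \<subseteq> Z2 \<and>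
    (\<exists>u :: 'z \<Rightarrow>\<^sub>L 'z. range (blinfun_apply u) \<subseteq> Z2 \<and> norm u \<le> l \<and>
      (\<forall>x\<in>Z1. blinfun_apply u x = x))" (is "?L \<longleftrightarrow> ?R")
proof
  assume ?L
  then obtain u :: "'z \<Rightarrow> 'z" where "\<forall>x y. u (x + y) = u x + u y"
    "\<forall>r x. u (r *\<^sub>R x) = r *\<^sub>R u x" "range u \<subseteq> Z2" "\<forall>x. norm (u x) \<le> l * norm x"
    "\<forall>x\<in>Z1. u x = x"
    unfolding approximable_def by (elim conjE exE) simp
  then have u: "\<And>x y. u (x + y) = u x + u y"
    "\<And>r x. u (r *\<^sub>R x) = r *\<^sub>R u x" "range u \<subseteq> Z2" "\<And>x. norm (u x) \<le> l * norm x"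
    "\<And>x. x \<in> Z1 \<Longrightarrow> u x = x"
    by blast+
  have "bounded_linear u"
    using u(1,2,4) by (intro bounded_linear_intro[of _ l]) (auto simp: mult.commute)
  then have app: "blinfun_apply (Blinfun u) = u"
    by (rule bounded_linear_Blinfun_apply)
  have "norm (Blinfun u) \<le> l"
    using assms u(4) by (intro norm_blinfun_bound) (auto simp: app)
  then show ?R
    using \<open>?L\<close> u(3,5) app unfolding approximable_def by (auto intro!: exI[of _ "Blinfun u"])
next
  assume R: ?R
  then obtain u :: "'z \<Rightarrow>\<^sub>L 'z" where u: "range (blinfun_apply u) \<subseteq> Z2" "norm u \<le> l"
    "\<forall>x\<in>Z1. blinfun_apply u x = x"
    by blast
  have "norm (blinfun_apply u x) \<le> l * norm x" for x
    using norm_blinfun[of u x] mult_right_mono[OF u(2) norm_ge_zero[of x]] by linarith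
  then show ?L
    using R u unfolding approximable_def
    by (auto intro!: exI[of _ "blinfun_apply u"] simp: blinfun.add_right blinfun.scaleR_right)
qed

end

theory Submission
  imports Defs
begin

text \<open>
  Suppose \<open>v\<^sub>n\<close> witnesses that \<open>M\<close> is quasibasic and \<open>u\<close> witnesses approximability of
  \<open>(X\<^sub>1, X\<^sub>2)\<close>.  For large \<open>n\<close> the operator \<open>u v\<^sub>n\<close> is almost the identity on \<open>X\<^sub>1\<close>; a small
  correction by functionals in \<open>M\<close> turns it into an operator \<open>w\<close> that is the identity there and
  satisfies \<open>f \<circ> w \<in> M\<close> for all functionals \<open>f\<close>.  The required operator on \<open>M\<^sup>*\<close> is
  \<open>G \<mapsto> (f \<mapsto> G (f \<circ> w))\<close>.

  Conversely, the bounded approximation property yields uniformly approximable pairs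
  \<open>(E\<^sub>i, F\<^sub>i)\<close> in which the \<open>E\<^sub>i\<close> increase to a dense subspace.  The operators on \<open>M\<^sup>*\<close> given by the
  hypothesis have coefficients in \<open>M\<^sup>*\<^sup>*\<close> only.  A Helly type argument, as in the
  principle of local reflexivity, replaces these by coefficients in \<open>M\<close> at the cost of a
  constant factor: otherwise the Hahn-Banach theorem in a finite \<open>\<ell>\<^sub>\<infinity>\<close>-sum of copies of \<open>X\<^sup>*\<close>
  gives a functional contradicting the bound on the given operator.  The resulting operators on
  \<open>X\<close> are bounded, are the identity on \<open>E\<^sub>i\<close>, and have adjoints with range in \<open>M\<close>.
\<close>

section \<open>The Hahn-Banach theorem\<close>

text \<open>Homogeneity is an inequality for positive \<open>r\<close> only, which is what the
  infima below verify directly. Equality and \<open>p 0 = 0\<close> follow by rescaling with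
  \<open>inverse r\<close>.\<close>

definition sublinear :: "('v::real_vector \<Rightarrow> real) \<Rightarrow> bool"
  where "sublinear p \<longleftrightarrow>
    (\<forall>x y. p (x + y) \<le> p x + p y) \<and> (\<forall>r>0. \<forall>x. p (r *\<^sub>R x) \<le> r * p x)"

lemma sublinear_add: "sublinear p \<Longrightarrow> p (x + y) \<le> p x + p y"
  by (simp add: sublinear_def)

lemma sublinear_scaleR: "sublinear p \<Longrightarrow> r > 0 \<Longrightarrow> p (r *\<^sub>R x) \<le> r * p x"
  by (simp add: sublinear_def)

lemma sublinear_0:
  assumes "sublinear p"
  shows "p 0 = 0"
  using sublinear_scaleR[OF assms, of 2 0] sublinear_scaleR[OF assms, of "1/2" 0] by simp

lemma sublinear_minus_le:
  assumes "sublinear p"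
  shows "- p (- x) \<le> p x"
  using sublinear_add[OF assms, of x "- x"] sublinear_0[OF assms] by simp

lemma sublinear_scaleR_eq:
  assumes "sublinear p" "r > 0"
  shows "p (r *\<^sub>R x) = r * p x"
proof -
  have "p x \<le> inverse r * p (r *\<^sub>R x)"
    using sublinear_scaleR[OF assms(1), of "inverse r" "r *\<^sub>R x"] assms(2) by simp
  then have "r * p x \<le> p (r *\<^sub>R x)"
    using assms(2) by (simp add: field_simps)
  then show ?thesis
    using sublinear_scaleR[OF assms] by (metis order_antisym)
qed

text \<open>The infimum of \<open>p (x + v) - c\<close> over the cone \<open>T\<close> is the
  required \<open>s\<close>. A pair \<open>(v, c)\<close> encodes the demand
  \<open>c \<le> Z v\<close>: a linear \<open>Z\<close> below \<open>s\<close> has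
  \<open>- Z v \<le> s (- v) \<le> - c\<close>. This serves both the minimality argument and the
  extension theorem.\<close>

lemma sublinear_inf_cone:
  fixes p :: "'v::real_vector \<Rightarrow> real" and T :: "('v \<times> real) set"
  assumes p: "sublinear p" and zero: "(0, 0) \<in> T"
    and add: "\<And>v c w d. (v, c) \<in> T \<Longrightarrow> (w, d) \<in> T \<Longrightarrow> (v + w, c + d) \<in> T"
    and scale: "\<And>r v c. r > 0 \<Longrightarrow> (v, c) \<in> T \<Longrightarrow> (r *\<^sub>R v, r * c) \<in> T"
    and below: "\<And>v c. (v, c) \<in> T \<Longrightarrow> c \<le> p v"
  obtains s where "sublinear s" "s \<le> p" "\<And>v c. (v, c) \<in> T \<Longrightarrow> s (- v) \<le> - c"
proof
  define s where "s x = (INF (v, c)\<in>T. p (x + v) - c)" for x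
  \<comment> \<open>A lower bound independent of \<open>(v, c)\<close>, so the infimum is a genuine
    real number.\<close>
  have lower: "- p (- x) \<le> p (x + v) - c" if "(v, c) \<in> T" for x v c
    using sublinear_add[OF p, of "x + v" "- x"] below[OF that] by simp
  have bdd: "bdd_below ((\<lambda>(v, c). p (x + v) - c) ` T)" for x
    using lower by (intro bdd_belowI[of _ "- p (- x)"]) auto
  have s_le: "s x \<le> p (x + v) - c" if "(v, c) \<in> T" for x v c
    unfolding s_def using cINF_lower[OF bdd that] by simp
  have s_ge: "a \<le> s x" if "\<And>v c. (v, c) \<in> T \<Longrightarrow> a \<le> p (x + v) - c" for a x
    unfolding s_def using zero that by (intro cINF_greatest) auto
  show "sublinear s"
    unfolding sublinear_def
  proof (intro conjI allI impI)
    fix x y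
    \<comment> \<open>The two infima are taken one after the other, first over the pairs used for
      \<open>x\<close>, then over those used for \<open>y\<close>.\<close>
    have "s (x + y) - (p (y + w) - d) \<le> s x" if "(w, d) \<in> T" for w d
    proof (rule s_ge)
      fix v c assume "(v, c) \<in> T"
      then show "s (x + y) - (p (y + w) - d) \<le> p (x + v) - c"
        using s_le[OF add[OF _ that], of v c "x + y"] sublinear_add[OF p, of "x + v" "y + w"]
        by (simp add: algebra_simps)
    qed
    then have "s (x + y) - s x \<le> s y"
      by (intro s_ge) (force simp: algebra_simps)
    then show "s (x + y) \<le> s x + s y" by simp
  next
    fix r :: real and x assume r: "r > 0"
    have "s (r *\<^sub>R x) / r \<le> s x"
    proof (rule s_ge)
      fix v c assume "(v, c) \<in> T"
      from s_le[OF scale[OF r this], of "r *\<^sub>R x"]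
      have "s (r *\<^sub>R x) \<le> p (r *\<^sub>R (x + v)) - r * c"
        by (simp add: scaleR_add_right)
      also have "\<dots> \<le> r * (p (x + v) - c)"
        using sublinear_scaleR[OF p r, of "x + v"] by (simp add: right_diff_distrib)
      finally show "s (r *\<^sub>R x) / r \<le> p (x + v) - c"
        using r by (simp add: field_simps)
    qed
    then show "s (r *\<^sub>R x) \<le> r * s x"
      using r by (simp add: field_simps)
  qed
  show "s \<le> p"
    using s_le[OF zero] by (simp add: le_fun_def)
  show "s (- v) \<le> - c" if "(v, c) \<in> T" for v c
    using s_le[OF that, of "- v"] sublinear_0[OF p] by simp
qed

text \<open>The pointwise infimum works. Subadditivity uses the chain condition: members
  \<open>s\<close> and \<open>t\<close> chosen for \<open>x\<close> and \<open>y\<close> can both be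
  replaced by the smaller of the two.\<close>

lemma sublinear_Inf_chain:
  fixes C :: "('v::real_vector \<Rightarrow> real) set"
  assumes C: "C \<noteq> {}" "\<And>s. s \<in> C \<Longrightarrow> sublinear s" "\<And>s. s \<in> C \<Longrightarrow> s \<le> p"
    and chain: "\<And>s t. s \<in> C \<Longrightarrow> t \<in> C \<Longrightarrow> s \<le> t \<or> t \<le> s"
  obtains m where "sublinear m" "m \<le> p" "\<And>s. s \<in> C \<Longrightarrow> m \<le> s"
proof
  define m where "m x = (INF s\<in>C. s x)" for x
  have lower: "- p (- x) \<le> s x" if "s \<in> C" for x s
    using sublinear_minus_le[OF C(2)[OF that], of x] le_funD[OF C(3)[OF that], of "- x"] by simp
  have bdd: "bdd_below ((\<lambda>s. s x) ` C)" for x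
    using lower by (intro bdd_belowI[of _ "- p (- x)"]) auto
  have m_le: "m x \<le> s x" if "s \<in> C" for s x
    unfolding m_def by (rule cINF_lower[OF bdd that])
  have m_ge: "a \<le> m x" if "\<And>s. s \<in> C \<Longrightarrow> a \<le> s x" for a x
    unfolding m_def using C(1) that by (rule cINF_greatest)
  show "sublinear m"
    unfolding sublinear_def
  proof (intro conjI allI impI)
    fix x y
    have "m (x + y) \<le> s x + t y" if st: "s \<in> C" "t \<in> C" for s t
    proof -
      obtain u where u: "u \<in> C" "u \<le> s" "u \<le> t"
        using chain[OF st] st by blast
      have "m (x + y) \<le> u x + u y"
        using m_le[OF u(1)] sublinear_add[OF C(2)[OF u(1)]] by (rule order_trans)
      also have "\<dots> \<le> s x + t y"
        using u by (intro add_mono) (auto simp: le_fun_def)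
      finally show ?thesis .
    qed
    then have "m (x + y) - t y \<le> m x" if "t \<in> C" for t
      using that by (intro m_ge) (simp add: algebra_simps)
    then have "m (x + y) - m x \<le> m y"
      by (intro m_ge) (force simp: algebra_simps)
    then show "m (x + y) \<le> m x + m y" by simp
  next
    fix r :: real and x assume r: "r > 0"
    have "m (r *\<^sub>R x) / r \<le> m x"
    proof (rule m_ge)
      fix s assume "s \<in> C"
      then have "m (r *\<^sub>R x) \<le> r * s x"
        using m_le sublinear_scaleR[OF C(2) r] by (blast intro: order_trans)
      then show "m (r *\<^sub>R x) / r \<le> s x"
        using r by (simp add: field_simps)
    qed
    then show "m (r *\<^sub>R x) \<le> r * m x"
      using r by (simp add: field_simps)
  qed
  show "m \<le> p"
    using C(1,3) m_le by (fastforce simp: le_fun_def intro: order_trans)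
  show "m \<le> s" if "s \<in> C" for s
    using m_le[OF that] by (simp add: le_fun_def)
qed

text \<open>A minimal sublinear functional is linear.\<close>
lemma linear_below_sublinear:
  fixes p :: "'v::real_vector \<Rightarrow> real"
  assumes p: "sublinear p"
  obtains Z where "linear Z" "Z \<le> p"
proof -
  define A where "A = {s. sublinear s \<and> s \<le> p}"
  have "\<exists>m\<in>A. \<forall>s\<in>A. s \<le> m \<longrightarrow> s = m"
  proof (rule predicate_Zorn)
    \<comment> \<open>The order is reversed, so that the maximal element from Zorn's lemma is a
      minimal sublinear functional.\<close>
    show "partial_order_on A (relation_of (\<lambda>s t. t \<le> s) A)"
      by (intro partial_order_on_relation_ofI) auto
    fix C assume "C \<in> Chains (relation_of (\<lambda>s t. t \<le> s) A)"
    then have C: "C \<subseteq> A" "\<And>s t. s \<in> C \<Longrightarrow> t \<in> C \<Longrightarrow> s \<le> t \<or> t \<le> s"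
      unfolding Chains_def relation_of_def by auto
    show "\<exists>u\<in>A. \<forall>s\<in>C. u \<le> s"
    proof (cases "C = {}")
      case True
      then show ?thesis using p by (auto simp: A_def)
    next
      case False
      show ?thesis
        by (rule sublinear_Inf_chain[OF False, of p]) (use C A_def in auto)
    qed
  qed
  then obtain Z where Z: "sublinear Z" "Z \<le> p"
    and min: "\<And>s. sublinear s \<Longrightarrow> s \<le> Z \<Longrightarrow> s = Z"
    unfolding A_def by (auto intro: order_trans)
  have minus: "Z (- y) = - Z y" for y
  proof -
    \<comment> \<open>The ray through \<open>(y, Z y)\<close> yields a sublinear
      \<open>s \<le> Z\<close> with \<open>s (- y) \<le> - Z y\<close>. Minimality forces
      \<open>s = Z\<close>, so \<open>Z\<close> is odd, and an odd sublinear functional is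
      linear.\<close>
    define T where "T = (\<lambda>t. (t *\<^sub>R y, t * Z y)) ` {0..}"
    obtain s where s: "sublinear s" "s \<le> Z" "\<And>v c. (v, c) \<in> T \<Longrightarrow> s (- v) \<le> - c"
    proof (rule sublinear_inf_cone[OF Z(1), of T])
      show "(0, 0) \<in> T"
        unfolding T_def by (auto intro!: image_eqI[of _ _ 0])
      show "(v + w, c + d) \<in> T" if "(v, c) \<in> T" "(w, d) \<in> T" for v c w d
        using that unfolding T_def
        by (auto simp: algebra_simps intro!: image_eqI[of _ _ "_ + _"])
      show "(r *\<^sub>R v, r * c) \<in> T" if "r > 0" "(v, c) \<in> T" for r v c
        using that unfolding T_def by (auto intro!: image_eqI[of _ _ "r * _"])
      show "c \<le> Z v" if vc: "(v, c) \<in> T" for v c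
      proof -
        obtain t where t: "t \<ge> 0" "v = t *\<^sub>R y" "c = t * Z y"
          using vc unfolding T_def by auto
        then show ?thesis
          using sublinear_scaleR_eq[OF Z(1), of t y] sublinear_0[OF Z(1)]
          by (cases "t = 0") auto
      qed
    qed blast
    have "(y, Z y) \<in> T"
      unfolding T_def by (auto intro!: image_eqI[of _ _ 1])
    then have "Z (- y) \<le> - Z y"
      using s(3) min[OF s(1,2)] by auto
    then show ?thesis
      using sublinear_minus_le[OF Z(1), of y] by simp
  qed
  have "linear Z"
  proof (rule linearI)
    show "Z (x + y) = Z x + Z y" for x y
      using sublinear_add[OF Z(1), of x y] sublinear_add[OF Z(1), of "x + y" "- y"]
      by (simp add: minus)
    show "Z (r *\<^sub>R x) = r *\<^sub>R Z x" for r x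
      using sublinear_scaleR_eq[OF Z(1), of r x] sublinear_scaleR_eq[OF Z(1), of "- r" x]
        minus[of "r *\<^sub>R x"] sublinear_0[OF Z(1)]
      by (cases r "0::real" rule: linorder_cases) auto
  qed
  then show thesis
    using Z(2) that by blast
qed

text \<open>The cone \<open>T\<close> prescribes the value \<open>d\<close> at \<open>v0\<close> and
  \<open>0\<close> on \<open>K\<close>. Since \<open>K\<close> is a subspace, the prescription at
  both \<open>k\<close> and \<open>- k\<close> turns the inequality there into
  \<open>Z k = 0\<close>.\<close>

theorem hahn_banach_distance:
  fixes p :: "'v::real_vector \<Rightarrow> real"
  assumes p: "sublinear p" and nonneg: "\<And>v. 0 \<le> p v"
    and K: "subspace K" and dist: "\<And>k. k \<in> K \<Longrightarrow> d \<le> p (v0 + k)"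
  obtains Z where "linear Z" "Z \<le> p" "\<And>k. k \<in> K \<Longrightarrow> Z k = 0" "d \<le> Z v0"
proof -
  define T where "T = {(t *\<^sub>R v0 + k, t * d) |t k. t \<ge> 0 \<and> k \<in> K}"
  have TI: "(t *\<^sub>R v0 + k, t * d) \<in> T" if "t \<ge> 0" "k \<in> K" for t k
    using that unfolding T_def by blast
  obtain s where s: "sublinear s" "s \<le> p" "\<And>v c. (v, c) \<in> T \<Longrightarrow> s (- v) \<le> - c"
  proof (rule sublinear_inf_cone[OF p, of T])
    show "(0, 0) \<in> T"
      using TI[of 0 0] subspace_0[OF K] by simp
    show "(v + w, c + e) \<in> T" if "(v, c) \<in> T" "(w, e) \<in> T" for v c w e
    proof -
      obtain t k t' k' where "t \<ge> 0" "k \<in> K" "t' \<ge> 0" "k' \<in> K"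
        "v = t *\<^sub>R v0 + k" "c = t * d" "w = t' *\<^sub>R v0 + k'" "e = t' * d"
        using \<open>(v, c) \<in> T\<close> \<open>(w, e) \<in> T\<close> unfolding T_def by blast
      then show ?thesis
        using TI[of "t + t'" "k + k'"] subspace_add[OF K] by (simp add: algebra_simps)
    qed
    show "(r *\<^sub>R v, r * c) \<in> T" if "r > 0" "(v, c) \<in> T" for r v c
    proof -
      obtain t k where "t \<ge> 0" "k \<in> K" "v = t *\<^sub>R v0 + k" "c = t * d"
        using \<open>(v, c) \<in> T\<close> unfolding T_def by blast
      then show ?thesis
        using TI[of "r * t" "r *\<^sub>R k"] subspace_scale[OF K] \<open>r > 0\<close>
        by (simp add: algebra_simps)
    qed
    show "c \<le> p v" if "(v, c) \<in> T" for v c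
    proof -
      obtain t k where t: "t \<ge> 0" "k \<in> K" "v = t *\<^sub>R v0 + k" "c = t * d"
        using \<open>(v, c) \<in> T\<close> unfolding T_def by blast
      show ?thesis
      proof (cases "t = 0")
        case True
        then show ?thesis using t nonneg by simp
      next
        case False
        then have "t > 0" using t by simp
        \<comment> \<open>Dividing by \<open>t\<close> keeps the second summand in \<open>K\<close>,
          where the distance assumption applies.\<close>
        have "t * d \<le> t * p (v0 + inverse t *\<^sub>R k)"
          using \<open>t > 0\<close> dist[OF subspace_scale[OF K \<open>k \<in> K\<close>]] by simp
        also have "\<dots> = p (t *\<^sub>R (v0 + inverse t *\<^sub>R k))"
          using sublinear_scaleR_eq[OF p \<open>t > 0\<close>] by simp
        also have "t *\<^sub>R (v0 + inverse t *\<^sub>R k) = v"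
          using t \<open>t > 0\<close> by (simp add: scaleR_add_right)
        finally show ?thesis using t by simp
      qed
    qed
  qed blast
  obtain Z where Z: "linear Z" "Z \<le> s"
    using linear_below_sublinear[OF s(1)] .
  have le: "c \<le> Z v" if "(v, c) \<in> T" for v c
    using s(3)[OF that] le_funD[OF Z(2), of "- v"] by (simp add: linear_neg[OF Z(1)])
  show thesis
  proof (rule that[OF Z(1)])
    show "Z \<le> p" using Z(2) s(2) by (rule order_trans)
    show "d \<le> Z v0" using le[OF TI[of 1 0]] subspace_0[OF K] by simp
    show "Z k = 0" if "k \<in> K" for k
      using le[OF TI[of 0 k]] le[OF TI[of 0 "- k"]] that subspace_neg[OF K that]
      by (simp add: linear_neg[OF Z(1)])
  qed
qed

section \<open>Uniform boundedness and biorthogonal systems\<close>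

text \<open>By Baire's theorem one of the closed sets \<open>C m\<close> contains a ball.
  Subtracting its centre moves the bound to a ball around \<open>0\<close>, at the cost of the
  factor 2 in \<open>K\<close>.\<close>

lemma uniform_boundedness:
  fixes v :: "nat \<Rightarrow> 'a::banach \<Rightarrow>\<^sub>L 'b::real_normed_vector"
  assumes ptw: "\<And>x. \<exists>K. \<forall>n. norm (v n x) \<le> K"
  obtains K where "K > 0" "\<And>n. norm (v n) \<le> K"
proof -
  define C where "C m = {x. \<forall>n. norm (v n x) \<le> real m}" for m
  have closed: "closed (C m)" for m
    unfolding C_def by (intro closed_Collect_all closed_Collect_le continuous_intros)
  have "(\<Union>m. C m) = UNIV"
    using ptw unfolding C_def by (auto) (meson order_trans real_arch_simple)
  have "\<exists>m. interior (C m) \<noteq> {}"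
  proof (rule ccontr)
    assume "\<not> ?thesis"
    then have "(euclidean :: 'a topology) interior_of \<Union> (range C) = {}"
      using closed
      by (intro Baire_category_alt) (auto simp: completely_metrizable_space_euclidean)
    then show False using \<open>(\<Union>m. C m) = UNIV\<close> by simp
  qed
  then obtain m x0 e where e: "e > 0" "cball x0 e \<subseteq> C m"
    by (metis ex_in_conv mem_interior_cball)
  define K where "K = 2 * real m / e"
  have "norm (v n x) \<le> K * norm x" for n x
  proof (cases "x = 0")
    case False
    define y where "y = (e / norm x) *\<^sub>R x"
    have "x0 \<in> C m" "x0 + y \<in> C m"
      using e False by (auto simp: y_def dist_norm intro!: subsetD[OF e(2)])
    then have "norm (v n x0) \<le> m" "norm (v n (x0 + y)) \<le> m"
      unfolding C_def by auto
    then have "norm (v n y) \<le> 2 * m"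
      using norm_triangle_ineq4[of "v n (x0 + y)" "v n x0"] by (simp add: blinfun.add_right)
    then show ?thesis
      using e False by (simp add: y_def K_def blinfun.scaleR_right field_simps)
  qed simp
  moreover have "K \<ge> 0" using e by (simp add: K_def)
  \<comment> \<open>The summand 1 makes the bound strictly positive even when
    \<open>m = 0\<close>.\<close>
  ultimately have "norm (v n) \<le> K + 1" for n
    by (intro order_trans[OF norm_blinfun_bound[of K]]) auto
  then show thesis using that[of "K + 1"] \<open>K \<ge> 0\<close> by simp
qed

section \<open>Coordinate functionals for finite-dimensional subspaces\<close>

text \<open>As \<open>M\<close> separates points, the coordinate functionals can be taken in
  \<open>M\<close> itself, by a Gram-Schmidt type induction. This keeps the operators built from
  them compatible with \<open>M\<close>.\<close>

lemma biorthogonal_exists: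
  fixes M :: "('a::real_normed_vector \<Rightarrow>\<^sub>L real) set"
  assumes M: "subspace M" and sep: "\<And>x. x \<noteq> 0 \<Longrightarrow> \<exists>f\<in>M. blinfun_apply f x \<noteq> 0"
    and "finite B" "independent B"
  obtains g where "\<And>b. b \<in> B \<Longrightarrow> g b \<in> M"
    "\<And>b b'. b \<in> B \<Longrightarrow> b' \<in> B \<Longrightarrow> blinfun_apply (g b) b' = (if b = b' then 1 else 0)"
proof -
  have "\<exists>g. (\<forall>b\<in>B. g b \<in> M) \<and>
      (\<forall>b\<in>B. \<forall>b'\<in>B. blinfun_apply (g b) b' = (if b = b' then 1 else 0))"
    using assms(3,4)
  proof (induction B)
    case (insert b0 B)
    then have ind: "b0 \<notin> span B" "independent B"
      by (auto simp: independent_insert)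
    then obtain g where g: "\<And>b. b \<in> B \<Longrightarrow> g b \<in> M"
      "\<And>b b'. b \<in> B \<Longrightarrow> b' \<in> B \<Longrightarrow> blinfun_apply (g b) b' = (if b = b' then 1 else 0)"
      using insert.IH by blast
    define y where "y = b0 - (\<Sum>b\<in>B. g b b0 *\<^sub>R b)"
    have "(\<Sum>b\<in>B. g b b0 *\<^sub>R b) \<in> span B"
      by (intro span_sum span_scale span_base)
    then have "y \<noteq> 0"
      using ind(1) unfolding y_def by auto
    then obtain f where f: "f \<in> M" "blinfun_apply f y \<noteq> 0"
      using sep by blast
    \<comment> \<open>Subtracting the sum makes the functional vanish on \<open>B\<close>; its value
      at \<open>b0\<close> is then exactly \<open>f y\<close>, which the factor normalizes to
      1.\<close>
    define f' where "f' = inverse (f y) *\<^sub>R (f - (\<Sum>b\<in>B. f b *\<^sub>R g b))"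
    have f'M: "f' \<in> M"
      unfolding f'_def using f g by (intro subspace_scale subspace_diff subspace_sum M) auto
    have f'B: "f' b' = 0" if "b' \<in> B" for b'
    proof -
      have "(\<Sum>b\<in>B. f b * g b b') = (\<Sum>b\<in>B. if b = b' then f b else 0)"
        using g(2) that by (intro sum.cong) auto
      then show ?thesis
        using that insert.hyps unfolding f'_def
        by (simp add: blinfun.scaleR_left blinfun.diff_left blinfun.sum_left)
    qed
    have "f y = f b0 - (\<Sum>b\<in>B. f b * g b b0)"
      by (simp add: y_def blinfun.diff_right blinfun.sum_right blinfun.scaleR_right mult.commute)
    then have f'b0: "f' b0 = 1"
      using f(2) unfolding f'_def
      by (simp add: blinfun.scaleR_left blinfun.diff_left blinfun.sum_left)
    \<comment> \<open>The old functionals are corrected at \<open>b0\<close> only, because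
      \<open>f'\<close> vanishes on \<open>B\<close>.\<close>
    define h where "h b = (if b = b0 then f' else g b - g b b0 *\<^sub>R f')" for b
    have "\<forall>b\<in>insert b0 B. h b \<in> M"
      using f'M g(1) by (auto simp: h_def intro!: subspace_diff subspace_scale M)
    moreover have "\<forall>b\<in>insert b0 B. \<forall>b'\<in>insert b0 B. h b b' = (if b = b' then 1 else 0)"
      using f'b0 f'B g(2) insert.hyps
      by (auto simp: h_def blinfun.scaleR_left blinfun.diff_left)
    ultimately show ?case by blast
  qed auto
  then show thesis using that by blast
qed

lemma biorthogonal_expansion:
  fixes g :: "'a::real_normed_vector \<Rightarrow> 'a \<Rightarrow>\<^sub>L real"
  assumes "finite B" "x \<in> span B"
    and g: "\<And>b b'. b \<in> B \<Longrightarrow> b' \<in> B \<Longrightarrow> blinfun_apply (g b) b' = (if b = b' then 1 else 0)"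
  shows "(\<Sum>b\<in>B. g b x *\<^sub>R b) = x"
proof -
  obtain a where x: "x = (\<Sum>b\<in>B. a b *\<^sub>R b)"
    using assms(1,2) span_finite by blast
  have "g b x = a b" if "b \<in> B" for b
  proof -
    have "g b x = (\<Sum>b'\<in>B. a b' * g b b')"
      by (simp add: x blinfun.sum_right blinfun.scaleR_right)
    also have "\<dots> = (\<Sum>b'\<in>B. if b = b' then a b' else 0)"
      using that g by (intro sum.cong) auto
    also have "\<dots> = a b" using that assms(1) by simp
    finally show ?thesis .
  qed
  then show ?thesis by (simp add: x)
qed

text \<open>The cube is a sum of compact segments. It gives the compactness of the unit sphere of
  \<open>span B\<close> needed for \<open>finite_norming_set\<close>.\<close>

lemma compact_coordinate_cube:
  fixes B :: "'a::real_normed_vector set"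
  assumes "finite B"
  shows "compact {\<Sum>b\<in>B. a b *\<^sub>R b |a. \<forall>b\<in>B. \<bar>a b\<bar> \<le> K}"
  using assms
proof (induction B)
  case (insert c B)
  have "{\<Sum>b\<in>insert c B. a b *\<^sub>R b |a. \<forall>b\<in>insert c B. \<bar>a b\<bar> \<le> K} =
    {x + y |x y. x \<in> (\<lambda>t. t *\<^sub>R c) ` {- K..K} \<and>
       y \<in> {\<Sum>b\<in>B. a b *\<^sub>R b |a. \<forall>b\<in>B. \<bar>a b\<bar> \<le> K}}" (is "?L = ?R")
  proof
    show "?L \<subseteq> ?R"
    proof
      fix z assume "z \<in> ?L"
      then obtain a where a: "z = (\<Sum>b\<in>insert c B. a b *\<^sub>R b)" "\<forall>b\<in>insert c B. \<bar>a b\<bar> \<le> K"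
        by blast
      moreover have "z = a c *\<^sub>R c + (\<Sum>b\<in>B. a b *\<^sub>R b)"
        using a insert.hyps by simp
      moreover have "a c \<in> {- K..K}" using a(2) by (simp add: abs_le_iff)
      ultimately show "z \<in> ?R" by blast
    qed
    show "?R \<subseteq> ?L"
    proof
      fix z assume "z \<in> ?R"
      then obtain t a where t: "t \<in> {- K..K}" and a: "\<forall>b\<in>B. \<bar>a b\<bar> \<le> K"
        and z: "z = t *\<^sub>R c + (\<Sum>b\<in>B. a b *\<^sub>R b)" by blast
      have "(\<Sum>b\<in>B. a b *\<^sub>R b) = (\<Sum>b\<in>B. (a(c := t)) b *\<^sub>R b)"
        using insert.hyps by (intro sum.cong) auto
      then have "z = (\<Sum>b\<in>insert c B. (a(c := t)) b *\<^sub>R b)"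
        using insert.hyps z by simp
      moreover have "\<forall>b\<in>insert c B. \<bar>(a(c := t)) b\<bar> \<le> K"
        using t a by (auto simp: abs_le_iff)
      ultimately show "z \<in> ?L" by blast
    qed
  qed
  moreover have "compact ((\<lambda>t. t *\<^sub>R c) ` {- K..K})"
    by (intro compact_continuous_image continuous_intros) auto
  ultimately show ?case
    using compact_sums[OF _ insert.IH] by simp
qed auto

section \<open>Finite-rank operators and the dual of a subspace\<close>

lemma finite_dim_subspace_basis:
  assumes "finite_dim_subspace S"
  obtains B where "finite B" "independent B" "span B = S"
proof -
  obtain C where C: "finite C" "span C = S"
    using assms unfolding finite_dim_subspace_def by blast
  obtain B where B: "B \<subseteq> C" "independent B" "C \<subseteq> span B"
    using maximal_independent_subset[of C] .
  have "span B = S"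
    using B C(2) by (metis span_mono span_span subset_antisym)
  then show thesis
    using that[of B] B C(1) finite_subset by blast
qed

lemma finite_dim_subspace_linear_image:
  assumes "linear f" "finite_dim_subspace S"
  shows "finite_dim_subspace (f ` S)"
  using assms linear_span_image[OF assms(1)] unfolding finite_dim_subspace_def
  by (metis finite_imageI)

lemma finite_rankI:
  fixes w :: "'a::real_normed_vector \<Rightarrow>\<^sub>L 'b::real_normed_vector"
  assumes "finite B" "range w \<subseteq> span B"
  shows "finite_rank w"
proof -
  have sub: "subspace (range w)"
    by (intro linear_subspace_image subspace_UNIV bounded_linear.linear blinfun.bounded_linear_right)
  obtain C where C: "C \<subseteq> range w" "independent C" "range w \<subseteq> span C"
    using maximal_independent_subset[of "range w"] .
  then have "finite C"
    using independent_span_bound[OF assms(1) C(2)] assms(2) by auto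
  moreover have "span C = range w"
    using C sub by (metis span_minimal subset_antisym)
  ultimately show ?thesis
    unfolding finite_rank_def finite_dim_subspace_def by blast
qed

text \<open>The tensor form of a finite-rank operator. Its adjoint sends \<open>f\<close> to a
  combination of the \<open>m b\<close>, so the range of the adjoint lies in \<open>M\<close> as
  soon as all \<open>m b\<close> do.\<close>

definition sum_op :: "'b set \<Rightarrow> ('b \<Rightarrow> 'a::real_normed_vector \<Rightarrow>\<^sub>L real) \<Rightarrow> ('b::real_normed_vector \<Rightarrow> 'c) \<Rightarrow>
    'a \<Rightarrow>\<^sub>L 'c::real_normed_vector"
  where "sum_op B m y = (\<Sum>b\<in>B. blinfun_scaleR_left (y b) o\<^sub>L m b)"

lemma sum_op_apply [simp]: "sum_op B m y x = (\<Sum>b\<in>B. m b x *\<^sub>R y b)"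
  by (simp add: sum_op_def blinfun.sum_left)

lemma compose_sum_op: "f o\<^sub>L sum_op B m y = (\<Sum>b\<in>B. f (y b) *\<^sub>R m b)"
  for f :: "'c::real_normed_vector \<Rightarrow>\<^sub>L real"
  by (rule blinfun_eqI)
    (simp add: blinfun.sum_left blinfun.sum_right blinfun.scaleR_left blinfun.scaleR_right mult.commute)

lemma norm_sum_op_le: "norm (sum_op B m y) \<le> (\<Sum>b\<in>B. norm (m b) * norm (y b))"
proof (rule norm_blinfun_bound)
  fix x
  have "norm (sum_op B m y x) \<le> (\<Sum>b\<in>B. norm (m b x *\<^sub>R y b))"
    using norm_sum[of "\<lambda>b. m b x *\<^sub>R y b" B] by simp
  also have "\<dots> \<le> (\<Sum>b\<in>B. norm (m b) * norm x * norm (y b))"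
    using norm_blinfun[of "m _" x] by (intro sum_mono) (simp add: mult_right_mono)
  finally show "norm (sum_op B m y x) \<le> (\<Sum>b\<in>B. norm (m b) * norm (y b)) * norm x"
    by (simp add: sum_distrib_left sum_distrib_right mult_ac)
qed (simp add: sum_nonneg)

section \<open>Functionals on a subspace and their norm\<close>

lemma subspace_dual_bdd_above:
  assumes "g \<in> subspace_dual M"
  shows "bdd_above ((\<lambda>f. \<bar>g f\<bar> / norm f) ` M)"
proof -
  obtain K where K: "\<forall>f\<in>M. \<bar>g f\<bar> \<le> K * norm f"
    using assms unfolding subspace_dual_def by blast
  have "\<bar>g f\<bar> / norm f \<le> \<bar>K\<bar>" if "f \<in> M" for f
    using K that by (cases "norm f = 0") (auto simp: divide_le_eq intro: order_trans mult_right_mono)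
  then show ?thesis by (intro bdd_aboveI[of _ "\<bar>K\<bar>"]) auto
qed

lemma subspace_dual_le_norm:
  assumes "g \<in> subspace_dual M" "f \<in> M"
  shows "\<bar>g f\<bar> \<le> subspace_dual_norm M g * norm f"
proof (cases "f = 0")
  case True
  then show ?thesis using assms unfolding subspace_dual_def by force
next
  case False
  have "\<bar>g f\<bar> / norm f \<le> subspace_dual_norm M g"
    unfolding subspace_dual_norm_def
    by (rule cSUP_upper[OF assms(2) subspace_dual_bdd_above[OF assms(1)]])
  then show ?thesis using False by (simp add: divide_le_eq)
qed

lemma subspace_dual_norm_le:
  assumes "M \<noteq> {}" "K \<ge> 0" "\<And>f. f \<in> M \<Longrightarrow> \<bar>g f\<bar> \<le> K * norm f"
  shows "subspace_dual_norm M g \<le> K"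
  unfolding subspace_dual_norm_def
proof (rule cSUP_least[OF assms(1)])
  fix f assume "f \<in> M"
  then show "\<bar>g f\<bar> / norm f \<le> K"
    using assms(2) assms(3)[of f] by (cases "norm f = 0") (auto simp: divide_le_eq)
qed

lemma subspace_dual_add:
  "g \<in> subspace_dual M \<Longrightarrow> f \<in> M \<Longrightarrow> h \<in> M \<Longrightarrow> g (f + h) = g f + g h"
  unfolding subspace_dual_def by blast

lemma subspace_dual_scaleR:
  "g \<in> subspace_dual M \<Longrightarrow> f \<in> M \<Longrightarrow> g (r *\<^sub>R f) = r * g f"
  unfolding subspace_dual_def by blast

lemma subspace_dual_sum:
  assumes "subspace M" "g \<in> subspace_dual M" "\<And>b. b \<in> B \<Longrightarrow> m b \<in> M"
  shows "g (\<Sum>b\<in>B. a b *\<^sub>R m b) = (\<Sum>b\<in>B. a b * g (m b))"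
  using assms(3)
proof (induction B rule: infinite_finite_induct)
  case (insert c B)
  then have "(\<Sum>b\<in>B. a b *\<^sub>R m b) \<in> M" "a c *\<^sub>R m c \<in> M"
    using assms(1) by (auto intro!: subspace_sum subspace_scale)
  then show ?case
    using insert assms(2) by (simp add: subspace_dual_add subspace_dual_scaleR)
qed (use subspace_dual_scaleR[OF assms(2) subspace_0[OF assms(1)], of 0] in auto)

lemma subspace_subspace_dual: "subspace (subspace_dual M)"
proof (rule subspaceI)
  show "0 \<in> subspace_dual M"
    unfolding subspace_dual_def by (auto intro!: exI[of _ 0])
next
  fix x y assume xy: "x \<in> subspace_dual M" "y \<in> subspace_dual M"
  obtain K L where K: "\<forall>f\<in>M. \<bar>x f\<bar> \<le> K * norm f" and L: "\<forall>f\<in>M. \<bar>y f\<bar> \<le> L * norm f"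
    using xy unfolding subspace_dual_def by blast
  have "\<forall>f\<in>M. \<bar>x f + y f\<bar> \<le> (K + L) * norm f"
  proof
    fix f assume "f \<in> M"
    then show "\<bar>x f + y f\<bar> \<le> (K + L) * norm f"
      using K L abs_triangle_ineq[of "x f" "y f"] by (force simp: distrib_right)
  qed
  then show "x + y \<in> subspace_dual M"
    using xy unfolding subspace_dual_def
    by (simp add: algebra_simps) (intro exI[of _ "K + L"], simp add: distrib_right)
next
  fix r x assume x: "x \<in> subspace_dual M"
  obtain K where K: "\<forall>f\<in>M. \<bar>x f\<bar> \<le> K * norm f"
    using x unfolding subspace_dual_def by blast
  have "\<forall>f\<in>M. \<bar>r * x f\<bar> \<le> (\<bar>r\<bar> * K) * norm f"
    using K by (auto simp: abs_mult mult.assoc intro!: mult_left_mono)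
  then show "r *\<^sub>R x \<in> subspace_dual M"
    using x unfolding subspace_dual_def
    by (simp add: scaleR_fun_def algebra_simps) (intro exI[of _ "\<bar>r\<bar> * K"], simp add: mult_ac)
qed

lemma subspace_dual_norm_attained_approx:
  assumes M: "subspace M" and g: "g \<in> subspace_dual M" and e: "e > 0"
  shows "\<exists>f\<in>M. norm f \<le> 1 \<and> subspace_dual_norm M g - e < g f"
proof -
  have "M \<noteq> {}" using subspace_0[OF M] by auto
  then obtain f where f: "f \<in> M" "subspace_dual_norm M g - e < \<bar>g f\<bar> / norm f"
    using e less_cSUP_iff[OF _ subspace_dual_bdd_above[OF g], of "subspace_dual_norm M g - e"]
    unfolding subspace_dual_norm_def by auto
  \<comment> \<open>The sign removes the absolute value. If \<open>f = 0\<close>, division by zero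
    makes both sides \<open>0\<close>.\<close>
  have "g ((sgn (g f) / norm f) *\<^sub>R f) = \<bar>g f\<bar> / norm f"
    using g f by (simp add: subspace_dual_scaleR abs_sgn mult.commute)
  moreover have "norm ((sgn (g f) / norm f) *\<^sub>R f) \<le> 1"
    by (simp add: abs_sgn_eq)
  ultimately show ?thesis
    using f subspace_scale[OF M f(1)] by metis
qed

section \<open>Operators factoring through a norming subspace\<close>

locale norming_subspace =
  fixes M :: "('a::real_normed_vector \<Rightarrow>\<^sub>L real) set" and c :: real
  assumes subspace_M: "subspace M" and c_pos: "c > 0"
    and norming_bound: "c * norm x \<le> (SUP f\<in>M. \<bar>blinfun_apply f x\<bar> / norm f)"
begin

text \<open>The restriction of the quotient map to the space itself: evaluation at \<open>x\<close>
  on \<open>M\<close>. The norming bound makes it injective and bounded below by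
  \<open>c\<close>.\<close>

definition J :: "'a \<Rightarrow> ('a \<Rightarrow>\<^sub>L real) \<Rightarrow> real"
  where "J x = quotient_map_dual M (canonical_embedding x)"

lemma J_apply: "J x f = (if f \<in> M then f x else 0)"
  by (simp add: J_def quotient_map_dual_def canonical_embedding.rep_eq)

lemma linear_J: "linear J"
  by (rule linearI)
    (auto simp: fun_eq_iff J_apply scaleR_fun_def blinfun.add_right blinfun.scaleR_right)

lemma J_in_dual: "J x \<in> subspace_dual M"
  unfolding J_def by (rule quotient_map_dual_in_dual[OF subspace_M])

lemma norm_le_norm_J: "c * norm x \<le> subspace_dual_norm M (J x)"
  using norming_bound[of x] unfolding subspace_dual_norm_def by (simp add: J_apply)

text \<open>The supremum need not be attained, hence \<open>c / 2\<close>. The strict inequality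
  gives open sets in the compactness argument below.\<close>

lemma norming_functional:
  assumes "x \<noteq> 0"
  obtains f where "f \<in> M" "norm f \<le> 1" "c / 2 * norm x < blinfun_apply f x"
proof -
  have "c / 2 * norm x > 0" using assms c_pos by simp
  then obtain f where "f \<in> M" "norm f \<le> 1" "subspace_dual_norm M (J x) - c / 2 * norm x < J x f"
    using subspace_dual_norm_attained_approx[OF subspace_M J_in_dual] by meson
  moreover have "c * norm x - c / 2 * norm x = c / 2 * norm x" by simp
  ultimately show thesis
    using that[of f] norm_le_norm_J[of x] by (simp add: J_apply)
qed

lemma M_separates: "x \<noteq> 0 \<Longrightarrow> \<exists>f\<in>M. blinfun_apply f x \<noteq> 0"
proof -
  assume "x \<noteq> 0"
  then obtain f where "f \<in> M" "c / 2 * norm x < blinfun_apply f x"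
    using norming_functional by metis
  moreover have "c / 2 * norm x > 0" using \<open>x \<noteq> 0\<close> c_pos by simp
  ultimately show ?thesis by force
qed

lemma inj_J: "J x = J y \<longleftrightarrow> x = y"
proof
  assume eq: "J x = J y"
  have "f (x - y) = 0" if "f \<in> M" for f
    using fun_cong[OF eq, of f] that by (simp add: J_apply blinfun.diff_right)
  then show "x = y" using M_separates[of "x - y"] by auto
qed simp

text \<open>The unit sphere of \<open>span B\<close> is compact and is covered by the open sets
  where some \<open>f\<close> in the unit ball of \<open>M\<close> exceeds \<open>c / 2\<close>; a
  finite subcover suffices.\<close>

lemma finite_norming_set:
  assumes B: "finite B" "independent B"
  obtains F where "finite F" "F \<noteq> {}" "F \<subseteq> M" "\<And>f. f \<in> F \<Longrightarrow> norm f \<le> 1"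
    "\<And>x. x \<in> span B \<Longrightarrow> x \<noteq> 0 \<Longrightarrow> \<exists>f\<in>F. c / 2 * norm x < blinfun_apply f x"
proof -
  obtain g where g: "\<And>b. b \<in> B \<Longrightarrow> g b \<in> M"
    "\<And>b b'. b \<in> B \<Longrightarrow> b' \<in> B \<Longrightarrow> blinfun_apply (g b) b' = (if b = b' then 1 else 0)"
    using biorthogonal_exists[OF subspace_M M_separates B] by blast
  \<comment> \<open>A bound for all coordinates of unit vectors of \<open>span B\<close>, so these
    vectors lie in \<open>Q\<close>.\<close>
  define K where "K = (\<Sum>b\<in>B. norm (g b))"
  define Q where "Q = {\<Sum>b\<in>B. a b *\<^sub>R b |a. \<forall>b\<in>B. \<bar>a b\<bar> \<le> K} \<inter> {x. norm x = 1}"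
  have "compact Q"
    unfolding Q_def by (intro compact_Int_closed compact_coordinate_cube B closed_Collect_eq continuous_intros)
  define H where "H = {f \<in> M. norm f \<le> 1}"
  have "Q \<subseteq> (\<Union>f\<in>H. {x. c / 2 < blinfun_apply f x})"
  proof
    fix x assume "x \<in> Q"
    then have "norm x = 1" "x \<noteq> 0" unfolding Q_def by auto
    then show "x \<in> (\<Union>f\<in>H. {x. c / 2 < blinfun_apply f x})"
      using norming_functional[of x] unfolding H_def by auto
  qed
  moreover have "open {x. c / 2 < blinfun_apply f x}" for f :: "'a \<Rightarrow>\<^sub>L real"
    by (intro open_Collect_less continuous_intros)
  ultimately obtain F0 where F0: "F0 \<subseteq> H" "finite F0"
    "Q \<subseteq> (\<Union>f\<in>F0. {x. c / 2 < blinfun_apply f x})"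
    using compactE_image[OF \<open>compact Q\<close>, of H "\<lambda>f. {x. c / 2 < blinfun_apply f x}"] by metis
  \<comment> \<open>Adding \<open>0\<close> keeps \<open>F\<close> nonempty when
    \<open>span B\<close> is trivial; a maximum over \<open>F\<close> is taken later.\<close>
  define F where "F = insert 0 F0"
  show thesis
  proof (rule that[of F])
    show "F \<subseteq> M" "\<And>f. f \<in> F \<Longrightarrow> norm f \<le> 1"
      using F0 subspace_0[OF subspace_M] by (auto simp: F_def H_def)
    fix x assume x: "x \<in> span B" "x \<noteq> 0"
    define y where "y = inverse (norm x) *\<^sub>R x"
    have y: "norm y = 1" "y \<in> span B"
      using x by (auto simp: y_def span_scale)
    have "\<bar>g b y\<bar> \<le> K" if "b \<in> B" for b
    proof -
      have "\<bar>g b y\<bar> \<le> norm (g b)"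
        using norm_blinfun[of "g b" y] y by simp
      also have "\<dots> \<le> K"
        unfolding K_def using that B by (intro member_le_sum) auto
      finally show ?thesis .
    qed
    then have "y \<in> Q"
      using y biorthogonal_expansion[OF B(1) y(2) g(2)] unfolding Q_def
      by (auto intro!: exI[of _ "\<lambda>b. g b y"])
    then obtain f where "f \<in> F0" "c / 2 < blinfun_apply f y"
      using F0 by blast
    then show "\<exists>f\<in>F. c / 2 * norm x < blinfun_apply f x"
      using x by (auto simp: F_def y_def blinfun.scaleR_right field_simps intro!: bexI[of _ f])
  qed (use F0 in \<open>auto simp: F_def\<close>)
qed

text \<open>Adding the sum of \<open>h a\<close> tensor \<open>a - T a\<close> repairs
  \<open>T\<close> on \<open>span A\<close>. The constant depends on \<open>A\<close> only, so an
  error \<open>1 / K\<close> costs at most 1 in norm; as the \<open>h a\<close> lie in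
  \<open>M\<close>, the condition on adjoints survives.\<close>

lemma correct_to_identity:
  assumes A: "finite A" "independent A"
  obtains K where "K > 0"
    "\<And>T e. e \<ge> 0 \<Longrightarrow> (\<And>a. a \<in> A \<Longrightarrow> norm (blinfun_apply T a - a) \<le> e) \<Longrightarrow>
      \<exists>T'. (\<forall>x\<in>span A. blinfun_apply T' x = x) \<and> norm T' \<le> norm T + K * e \<and>
        (\<forall>x. blinfun_apply T' x - blinfun_apply T x \<in> span ((\<lambda>a. a - blinfun_apply T a) ` A)) \<and>
        (\<forall>f :: 'a \<Rightarrow>\<^sub>L real. f o\<^sub>L T \<in> M \<longrightarrow> f o\<^sub>L T' \<in> M)"
proof -
  obtain h where h: "\<And>b. b \<in> A \<Longrightarrow> h b \<in> M"
    "\<And>b b'. b \<in> A \<Longrightarrow> b' \<in> A \<Longrightarrow> blinfun_apply (h b) b' = (if b = b' then 1 else 0)"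
    using biorthogonal_exists[OF subspace_M M_separates A] by blast
  define K where "K = (\<Sum>a\<in>A. norm (h a)) + 1"
  have "K > 0" unfolding K_def by (simp add: add_nonneg_pos sum_nonneg)
  moreover have "\<exists>T'. (\<forall>x\<in>span A. blinfun_apply T' x = x) \<and> norm T' \<le> norm T + K * e \<and>
      (\<forall>x. blinfun_apply T' x - blinfun_apply T x \<in> span ((\<lambda>a. a - blinfun_apply T a) ` A)) \<and>
      (\<forall>f :: 'a \<Rightarrow>\<^sub>L real. f o\<^sub>L T \<in> M \<longrightarrow> f o\<^sub>L T' \<in> M)"
    if T: "\<And>a. a \<in> A \<Longrightarrow> norm (blinfun_apply T a - a) \<le> e" and "e \<ge> 0" for T and e :: real
  proof (intro exI conjI ballI allI impI)
    define T' where "T' = T + sum_op A h (\<lambda>a. a - T a)"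
    have T'_apply: "T' x = T x + (\<Sum>a\<in>A. h a x *\<^sub>R (a - T a))" for x
      by (simp add: T'_def blinfun.add_left)
    show "T' x = x" if "x \<in> span A" for x
    proof -
      have x: "x = (\<Sum>a\<in>A. h a x *\<^sub>R a)"
        using biorthogonal_expansion[OF A(1) that h(2)] by simp
      have "T x = (\<Sum>a\<in>A. h a x *\<^sub>R T a)"
        by (subst x) (simp add: blinfun.sum_right blinfun.scaleR_right)
      then show ?thesis
        using x by (simp add: T'_apply scaleR_diff_right sum_subtractf)
    qed
    have "norm (sum_op A h (\<lambda>a. a - T a)) \<le> (\<Sum>a\<in>A. norm (h a) * norm (a - T a))"
      by (rule norm_sum_op_le)
    also have "\<dots> \<le> (\<Sum>a\<in>A. norm (h a) * e)"
      using T by (intro sum_mono mult_left_mono) (auto simp: norm_minus_commute)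
    also have "\<dots> \<le> K * e"
      using \<open>e \<ge> 0\<close> by (simp add: K_def sum_distrib_right distrib_right)
    finally show "norm T' \<le> norm T + K * e"
      unfolding T'_def using norm_triangle_ineq by (smt (verit))
    show "T' x - T x \<in> span ((\<lambda>a. a - T a) ` A)" for x
      unfolding T'_apply by (simp, intro span_sum span_scale span_base) auto
    fix f :: "'a \<Rightarrow>\<^sub>L real" assume "f o\<^sub>L T \<in> M"
    moreover have "f o\<^sub>L T' = (f o\<^sub>L T) + (\<Sum>a\<in>A. f (a - T a) *\<^sub>R h a)"
      by (simp add: T'_def bounded_bilinear.add_right[OF bounded_bilinear_blinfun_compose] compose_sum_op)
    ultimately show "f o\<^sub>L T' \<in> M"
      using h(1) by (auto intro!: subspace_add subspace_sum subspace_scale subspace_M)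
  qed
  ultimately show thesis
    using that by blast
qed

section \<open>From operators on the space to operators on the dual of \<open>M\<close>\<close>

text \<open>The adjoint of \<open>w\<close> maps into \<open>M\<close>, so composing
  \<open>G\<close> with it is meaningful and gives the operator \<open>U\<close>, a version of the
  second adjoint of \<open>w\<close>.\<close>

lemma approximable_dualI:
  assumes X1: "finite_dim_subspace X1" and X2: "finite_dim_subspace X2" and "X1 \<subseteq> X2"
    and w: "range (blinfun_apply w) \<subseteq> X2" "\<And>x. x \<in> X1 \<Longrightarrow> blinfun_apply w x = x"
    and l: "norm w \<le> l"
    and M: "\<And>f :: 'a \<Rightarrow>\<^sub>L real. f o\<^sub>L w \<in> M"
  shows "approximable (subspace_dual M) (subspace_dual_norm M) l (J ` X1) (J ` X2)"
proof -
  obtain B where B: "finite B" "independent B" "span B = X2"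
    using finite_dim_subspace_basis[OF X2] .
  obtain g where g: "\<And>b. b \<in> B \<Longrightarrow> g b \<in> M"
    "\<And>b b'. b \<in> B \<Longrightarrow> b' \<in> B \<Longrightarrow> blinfun_apply (g b) b' = (if b = b' then 1 else 0)"
    using biorthogonal_exists[OF subspace_M M_separates B(1,2)] by blast
  define U :: "(('a \<Rightarrow>\<^sub>L real) \<Rightarrow> real) \<Rightarrow> ('a \<Rightarrow>\<^sub>L real) \<Rightarrow> real"
    where "U G f = (if f \<in> M then G (f o\<^sub>L w) else 0)" for G f
  \<comment> \<open>Since \<open>w\<close> has range in \<open>span B\<close>, each
    \<open>f o\<^sub>L w\<close> is a combination of the fixed functionals
    \<open>g b o\<^sub>L w\<close>. Hence \<open>U G\<close> is evaluation at a point of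
    \<open>X2\<close>.\<close>
  have U_eq: "U G = J (\<Sum>b\<in>B. G (g b o\<^sub>L w) *\<^sub>R b)" if G: "G \<in> subspace_dual M" for G
  proof
    fix f
    have "f o\<^sub>L w = (\<Sum>b\<in>B. f b *\<^sub>R (g b o\<^sub>L w))"
    proof (rule blinfun_eqI)
      fix x
      have "w x = (\<Sum>b\<in>B. g b (w x) *\<^sub>R b)"
        using biorthogonal_expansion[OF B(1) _ g(2), of "w x"] w(1) B(3) by (simp add: image_subset_iff)
      then have "f (w x) = f (\<Sum>b\<in>B. g b (w x) *\<^sub>R b)" by simp
      then show "(f o\<^sub>L w) x = (\<Sum>b\<in>B. f b *\<^sub>R (g b o\<^sub>L w)) x"
        by (simp add: blinfun.sum_left blinfun.sum_right blinfun.scaleR_left blinfun.scaleR_right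
            mult.commute)
    qed
    then have "G (f o\<^sub>L w) = (\<Sum>b\<in>B. f b * G (g b o\<^sub>L w))"
      using subspace_dual_sum[OF subspace_M G, of B "\<lambda>b. g b o\<^sub>L w"] M by simp
    then show "U G f = J (\<Sum>b\<in>B. G (g b o\<^sub>L w) *\<^sub>R b) f"
      by (simp add: U_def J_apply blinfun.sum_right blinfun.scaleR_right mult.commute)
  qed
  have norm_U: "subspace_dual_norm M (U G) \<le> l * subspace_dual_norm M G"
    if G: "G \<in> subspace_dual M" for G
  proof (rule subspace_dual_norm_le)
    show "M \<noteq> {}" using subspace_0[OF subspace_M] by auto
    have "0 \<in> M" using subspace_0[OF subspace_M] .
    have N: "0 \<le> subspace_dual_norm M G"
      unfolding subspace_dual_norm_def
      using cSUP_upper[OF \<open>0 \<in> M\<close> subspace_dual_bdd_above[OF G]] by simp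
    have "0 \<le> l" using l norm_ge_zero order_trans by blast
    then show "0 \<le> l * subspace_dual_norm M G" using N by simp
    fix f assume "f \<in> M"
    then have "\<bar>U G f\<bar> \<le> subspace_dual_norm M G * norm (f o\<^sub>L w)"
      using subspace_dual_le_norm[OF G M] by (simp add: U_def)
    also have "\<dots> \<le> subspace_dual_norm M G * (norm f * l)"
      using N norm_blinfun_compose[of f w] mult_left_mono[OF l norm_ge_zero[of f]]
      by (intro mult_left_mono) auto
    finally show "\<bar>U G f\<bar> \<le> l * subspace_dual_norm M G * norm f"
      by (simp add: mult_ac)
  qed
  have "U (G + H) = U G + U H" for G H
    by (auto simp: U_def fun_eq_iff)
  moreover have "U (r *\<^sub>R G) = r *\<^sub>R U G" for r G
    by (auto simp: U_def fun_eq_iff scaleR_fun_def)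
  moreover have "U ` subspace_dual M \<subseteq> J ` X2"
    using U_eq by (auto simp: B(3)[symmetric] intro!: imageI span_sum intro: span_scale span_base)
  moreover have "U (J x) = J x" if "x \<in> X1" for x
    using w(2)[OF that] M by (auto simp: U_def J_apply fun_eq_iff)
  ultimately show ?thesis
    using norm_U X1 X2 \<open>X1 \<subseteq> X2\<close> J_in_dual linear_J unfolding approximable_def
    by (auto intro!: finite_dim_subspace_linear_image exI[of _ U])
qed

section \<open>From operators on the dual of \<open>M\<close> back to the space\<close>

text \<open>The dual of a finite supremum-norm sum is the sum of the duals with added norms.
  Families are total functions of which only the entries in \<open>F\<close> count.\<close>

lemma sup_norm_functional_bound:
  fixes Z :: "(('a \<Rightarrow>\<^sub>L real) \<Rightarrow> ('a \<Rightarrow>\<^sub>L real)) \<Rightarrow> real"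
  assumes F: "finite F" "F \<noteq> {}"
    and Z: "linear Z" "\<And>n. Z n \<le> Max ((\<lambda>f. norm (n f)) ` F)"
  obtains z where "\<And>f. f \<in> F \<Longrightarrow> z f \<in> subspace_dual M"
    "\<And>n. (\<And>f. f \<in> F \<Longrightarrow> n f \<in> M) \<Longrightarrow> Z n = (\<Sum>f\<in>F. z f (n f))"
    "(\<Sum>f\<in>F. subspace_dual_norm M (z f)) \<le> 1"
proof -
  define e :: "('a \<Rightarrow>\<^sub>L real) \<Rightarrow> ('a \<Rightarrow>\<^sub>L real) \<Rightarrow> ('a \<Rightarrow>\<^sub>L real) \<Rightarrow> ('a \<Rightarrow>\<^sub>L real)"
    where "e f m = (\<lambda>h. if h = f then m else 0)" for f m
  have Z_le: "Z n \<le> K" if "\<And>f. f \<in> F \<Longrightarrow> norm (n f) \<le> K" for n K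
  proof -
    have "Max ((\<lambda>f. norm (n f)) ` F) \<le> K" using that F by simp
    then show ?thesis using Z(2)[of n] by (rule order_trans[rotated])
  qed
  have Z_vanish: "Z n = 0" if "\<And>f. f \<in> F \<Longrightarrow> n f = 0" for n
    using Z_le[of n 0] Z_le[of "- n" 0] that by (simp add: linear_neg[OF Z(1)])
  define z where "z f m = (if m \<in> M then Z (e f m) else 0)" for f m
  have e_add: "e f (m + m') = e f m + e f m'" and e_scale: "e f (r *\<^sub>R m) = r *\<^sub>R e f m"
    for f m m' r
    by (auto simp: e_def fun_eq_iff scaleR_fun_def)
  have Z_e: "\<bar>Z (e f m)\<bar> \<le> norm m" for f m
  proof -
    have "Z (e f m) \<le> norm m" "Z (- e f m) \<le> norm m"
      by (intro Z_le; simp add: e_def)+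
    then show ?thesis by (simp add: linear_neg[OF Z(1)] abs_le_iff)
  qed
  have z_dual: "z f \<in> subspace_dual M" for f
    unfolding subspace_dual_def mem_Collect_eq
  proof (intro conjI ballI allI impI)
    show "z f (m + m') = z f m + z f m'" if "m \<in> M" "m' \<in> M" for m m'
      using that subspace_add[OF subspace_M that] by (simp add: z_def e_add linear_add[OF Z(1)])
    show "z f (r *\<^sub>R m) = r * z f m" if "m \<in> M" for m r
      using that subspace_scale[OF subspace_M that]
      by (simp add: z_def e_scale linear_scale[OF Z(1)])
    show "\<exists>K. \<forall>m\<in>M. \<bar>z f m\<bar> \<le> K * norm m"
      using Z_e[of f] by (intro exI[of _ 1]) (simp add: z_def)
    show "z f m = 0" if "m \<notin> M" for m
      using that by (simp add: z_def)
  qed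
  have Z_sum: "Z n = (\<Sum>f\<in>F. z f (n f))" if n: "\<And>f. f \<in> F \<Longrightarrow> n f \<in> M" for n
  proof -
    have sum_apply: "(\<Sum>f\<in>G. e f (n f)) h = (if h \<in> G then n h else 0)" if "finite G" for G h
      using that by (induction G) (auto simp: e_def)
    have "Z (n - (\<Sum>f\<in>F. e f (n f))) = 0"
      by (rule Z_vanish) (simp add: sum_apply[OF F(1)])
    then have "Z n = Z (\<Sum>f\<in>F. e f (n f))"
      by (simp add: linear_diff[OF Z(1)])
    also have "\<dots> = (\<Sum>f\<in>F. z f (n f))"
      using n by (simp add: linear_sum[OF Z(1)] z_def)
    finally show ?thesis .
  qed
  have "(\<Sum>f\<in>F. subspace_dual_norm M (z f)) \<le> 1"
  proof (rule field_le_epsilon)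
    fix d :: real assume d: "d > 0"
    \<comment> \<open>The error \<open>d\<close> is shared equally among the members of
      \<open>F\<close>: one family \<open>m\<close> in the unit ball nearly attains all the norms at
      once.\<close>
    define \<delta> where "\<delta> = d / card F"
    have "\<delta> > 0" using d F by (simp add: \<delta>_def card_gt_0_iff)
    then obtain m where m: "\<And>f. m f \<in> M" "\<And>f. norm (m f) \<le> 1"
      "\<And>f. subspace_dual_norm M (z f) - \<delta> < z f (m f)"
      using subspace_dual_norm_attained_approx[OF subspace_M z_dual] by metis
    have "(\<Sum>f\<in>F. subspace_dual_norm M (z f)) \<le> (\<Sum>f\<in>F. z f (m f) + \<delta>)"
      using m(3) by (intro sum_mono) (simp add: less_imp_le diff_le_eq[symmetric])
    also have "\<dots> = Z m + d"
      using Z_sum[of m] m(1) F by (simp add: sum.distrib \<delta>_def)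
    also have "\<dots> \<le> 1 + d"
      using Z_le[of m 1] m(2) by simp
    finally show "(\<Sum>f\<in>F. subspace_dual_norm M (z f)) \<le> 1 + d" .
  qed
  then show thesis
    using that[of z] z_dual Z_sum by blast
qed

text \<open>
  The finite set \<open>F\<close> below norms \<open>span B\<close> up to the factor \<open>2 / c\<close>, so the norm of
  \<open>\<Sum>b\<in>B. m b \<otimes> b\<close> is controlled by \<open>p (\<theta> m)\<close>.  Adding elements of \<open>D\<close> to \<open>m\<close> does not change
  the operator on \<open>A\<close>, so the task is to bound the distance of \<open>\<theta> m0\<close> from \<open>\<theta> ` D\<close>.  A functional
  \<open>Z\<close> realizing that distance is given on \<open>M\<close> by elements of \<open>span A\<close>, which \<open>U\<close> fixes; hence
  \<open>Z (\<theta> m0)\<close> is a trace involving \<open>U\<close>, bounded by the norm of \<open>U\<close>.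
\<close>
lemma factor_through_M:
  assumes A: "finite A" "independent A" and B: "finite B" "independent B"
    and AB: "A \<subseteq> span B" and L: "L \<ge> 0"
    and U_add: "\<And>G H. G \<in> subspace_dual M \<Longrightarrow> H \<in> subspace_dual M \<Longrightarrow> U (G + H) = U G + U H"
    and U_scale: "\<And>r G. G \<in> subspace_dual M \<Longrightarrow> U (r *\<^sub>R G) = r *\<^sub>R U G"
    and U_range: "\<And>G. G \<in> subspace_dual M \<Longrightarrow> U G \<in> J ` span B"
    and U_norm: "\<And>G. G \<in> subspace_dual M \<Longrightarrow>
      subspace_dual_norm M (U G) \<le> L * subspace_dual_norm M G"
    and U_id: "\<And>x. x \<in> span A \<Longrightarrow> U (J x) = J x"
  obtains w where "range (blinfun_apply w) \<subseteq> span B" "\<And>x. x \<in> span A \<Longrightarrow> blinfun_apply w x = x"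
    "\<And>f :: 'a \<Rightarrow>\<^sub>L real. f o\<^sub>L w \<in> M" "norm w \<le> 2 / c * (L / c + 1)"
proof -
  obtain g where g: "\<And>b. b \<in> B \<Longrightarrow> g b \<in> M"
    "\<And>b b'. b \<in> B \<Longrightarrow> b' \<in> B \<Longrightarrow> blinfun_apply (g b) b' = (if b = b' then 1 else 0)"
    using biorthogonal_exists[OF subspace_M M_separates B] by blast
  obtain h where h: "\<And>b. b \<in> A \<Longrightarrow> h b \<in> M"
    "\<And>b b'. b \<in> A \<Longrightarrow> b' \<in> A \<Longrightarrow> blinfun_apply (h b) b' = (if b = b' then 1 else 0)"
    using biorthogonal_exists[OF subspace_M M_separates A] by blast
  obtain F where F: "finite F" "F \<noteq> {}" "F \<subseteq> M" "\<And>f. f \<in> F \<Longrightarrow> norm f \<le> 1"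
    "\<And>x. x \<in> span B \<Longrightarrow> x \<noteq> 0 \<Longrightarrow> \<exists>f\<in>F. c / 2 * norm x < blinfun_apply f x"
    using finite_norming_set[OF B] by blast
  \<comment> \<open>\<open>\<theta> m\<close> is the adjoint of the operator with coefficients
    \<open>m b\<close> at the basis vectors \<open>b\<close>.\<close>
  define \<theta> :: "('a \<Rightarrow> 'a \<Rightarrow>\<^sub>L real) \<Rightarrow> ('a \<Rightarrow>\<^sub>L real) \<Rightarrow> 'a \<Rightarrow>\<^sub>L real"
    where "\<theta> m f = (\<Sum>b\<in>B. f b *\<^sub>R m b)" for m f
  have lin_\<theta>: "linear \<theta>"
    by (rule linearI)
      (auto simp: \<theta>_def fun_eq_iff scaleR_fun_def sum.distrib scaleR_add_right scaleR_sum_right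
        mult.commute)
  have \<theta>_M: "\<theta> m f \<in> M" if "\<And>b. b \<in> B \<Longrightarrow> m b \<in> M" for m f
    unfolding \<theta>_def using that by (intro subspace_sum subspace_scale subspace_M) auto
  define D where "D = {m :: 'a \<Rightarrow> 'a \<Rightarrow>\<^sub>L real. \<forall>b. m b \<in> M \<and> (\<forall>a\<in>A. m b a = 0)}"
  have "subspace D"
    unfolding D_def
    by (rule subspaceI)
      (auto simp: scaleR_fun_def blinfun.add_left blinfun.scaleR_left
        intro: subspace_0 subspace_add subspace_scale subspace_M)
  then have subD: "subspace (\<theta> ` D)"
    using lin_\<theta> linear_subspace_image by blast
  \<comment> \<open>A first choice of coefficients in \<open>M\<close>, agreeing with
    \<open>g b\<close> on \<open>A\<close>: the operator is the identity on \<open>span A\<close>,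
    but its norm is not yet controlled.\<close>
  define m0 where "m0 b = (\<Sum>a\<in>A. g b a *\<^sub>R h a)" for b
  have m0_M: "m0 b \<in> M" for b
    unfolding m0_def using h by (intro subspace_sum subspace_scale subspace_M) auto
  have m0_A: "m0 b a = g b a" if "a \<in> A" for a b
  proof -
    have "m0 b a = (\<Sum>a'\<in>A. if a' = a then g b a' else 0)"
      unfolding m0_def using h(2)[OF _ that]
      by (auto simp: blinfun.sum_left blinfun.scaleR_left intro!: sum.cong)
    then show ?thesis using that A by simp
  qed
  define p :: "(('a \<Rightarrow>\<^sub>L real) \<Rightarrow> 'a \<Rightarrow>\<^sub>L real) \<Rightarrow> real"
    where "p n = Max ((\<lambda>f. norm (n f)) ` F)" for n
  have p_ge: "norm (n f) \<le> p n" if "f \<in> F" for n f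
    unfolding p_def using that F(1) by simp
  have p_le: "p n \<le> K" if "\<And>f. f \<in> F \<Longrightarrow> norm (n f) \<le> K" for n K
    unfolding p_def using that F(1,2) by simp
  have p_nonneg: "0 \<le> p n" for n
    using F(2) p_ge norm_ge_zero order_trans by blast
  have "sublinear p"
    unfolding sublinear_def
  proof (intro conjI allI impI)
    show "p (x + y) \<le> p x + p y" for x y
      by (rule p_le) (auto intro: norm_triangle_mono p_ge)
    show "p (r *\<^sub>R x) \<le> r * p x" if "r > 0" for r x
      using that by (intro p_le) (auto simp: scaleR_fun_def intro: p_ge)
  qed
  \<comment> \<open>The trace estimate below gives at most \<open>L / c\<close>; the extra 1 makes
    the contradiction strict.\<close>
  have "\<exists>k\<in>\<theta> ` D. p (\<theta> m0 + k) < L / c + 1"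
  proof (rule ccontr)
    assume "\<not> ?thesis"
    then have dist: "L / c + 1 \<le> p (\<theta> m0 + k)" if "k \<in> \<theta> ` D" for k
      using that by force
    obtain Z where Z: "linear Z" "Z \<le> p" "\<And>k. k \<in> \<theta> ` D \<Longrightarrow> Z k = 0" "L / c + 1 \<le> Z (\<theta> m0)"
      using hahn_banach_distance[OF \<open>sublinear p\<close>, of "\<theta> ` D" "L / c + 1" "\<theta> m0"]
        p_nonneg subD dist by blast
    have "Z n \<le> Max ((\<lambda>f. norm (n f)) ` F)" for n
      using le_funD[OF Z(2), of n] by (simp add: p_def)
    then obtain z where z: "\<And>f. f \<in> F \<Longrightarrow> z f \<in> subspace_dual M"
      "\<And>n. (\<And>f. f \<in> F \<Longrightarrow> n f \<in> M) \<Longrightarrow> Z n = (\<Sum>f\<in>F. z f (n f))"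
      "(\<Sum>f\<in>F. subspace_dual_norm M (z f)) \<le> 1"
      using sup_norm_functional_bound[OF F(1,2) Z(1)] by blast
    \<comment> \<open>Regrouping \<open>Z\<close> by basis vectors: \<open>\<zeta> b\<close> is the
      functional applied to the coefficient \<open>m b\<close>.\<close>
    define \<zeta> where "\<zeta> b = (\<Sum>f\<in>F. blinfun_apply f b *\<^sub>R z f)" for b
    have \<zeta>_dual: "\<zeta> b \<in> subspace_dual M" for b
      unfolding \<zeta>_def using z(1) by (intro subspace_sum subspace_scale subspace_subspace_dual) auto
    have sum_fun: "(\<Sum>f\<in>G. blinfun_apply f b *\<^sub>R z f) \<mu> = (\<Sum>f\<in>G. blinfun_apply f b * z f \<mu>)" for G b \<mu>
      by (induction G rule: infinite_finite_induct) (auto simp: scaleR_fun_def)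
    have Z_\<theta>: "Z (\<theta> m) = (\<Sum>b\<in>B. \<zeta> b (m b))" if m: "\<And>b. b \<in> B \<Longrightarrow> m b \<in> M" for m
    proof -
      have "Z (\<theta> m) = (\<Sum>f\<in>F. z f (\<theta> m f))"
        using z(2) \<theta>_M m by blast
      also have "\<dots> = (\<Sum>f\<in>F. \<Sum>b\<in>B. blinfun_apply f b * z f (m b))"
        unfolding \<theta>_def by (intro sum.cong refl subspace_dual_sum[OF subspace_M] z m)
      also have "\<dots> = (\<Sum>b\<in>B. \<Sum>f\<in>F. blinfun_apply f b * z f (m b))"
        by (rule sum.swap)
      finally show ?thesis by (simp add: \<zeta>_def sum_fun)
    qed
    have \<zeta>_0: "\<zeta> b \<mu> = 0" if b: "b \<in> B" and \<mu>: "\<mu> \<in> M" "\<And>a. a \<in> A \<Longrightarrow> \<mu> a = 0" for b \<mu>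
    proof -
      \<comment> \<open>A family with the single entry \<open>\<mu>\<close> belongs to
        \<open>D\<close>, where \<open>Z\<close> vanishes.\<close>
      have "(\<lambda>b'. if b' = b then \<mu> else 0) \<in> D"
        using \<mu> subspace_0[OF subspace_M] by (auto simp: D_def)
      then have "Z (\<theta> (\<lambda>b'. if b' = b then \<mu> else 0)) = 0"
        using Z(3) by blast
      moreover have "Z (\<theta> (\<lambda>b'. if b' = b then \<mu> else 0)) =
          (\<Sum>b'\<in>B. \<zeta> b' (if b' = b then \<mu> else 0))"
        using \<mu> subspace_0[OF subspace_M] by (intro Z_\<theta>) auto
      moreover have "\<zeta> b' 0 = 0" for b'
        using subspace_dual_scaleR[OF \<zeta>_dual subspace_0[OF subspace_M], where r = 0] by simp
      then have "(\<Sum>b'\<in>B. \<zeta> b' (if b' = b then \<mu> else 0)) = (\<Sum>b'\<in>B. if b' = b then \<zeta> b \<mu> else 0)"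
        by (intro sum.cong) auto
      ultimately show ?thesis using b B by simp
    qed
    \<comment> \<open>As \<open>\<zeta> b\<close> vanishes on functionals that are zero on
      \<open>A\<close>, it depends only on their values on \<open>A\<close>; so it is evaluation at
      the point \<open>y b\<close> of \<open>span A\<close>.\<close>
    define y where "y b = (\<Sum>a\<in>A. \<zeta> b (h a) *\<^sub>R a)" for b
    have y_span: "y b \<in> span A" for b
      unfolding y_def by (intro span_sum span_scale span_base)
    have \<zeta>_J: "\<zeta> b = J (y b)" if b: "b \<in> B" for b
    proof
      fix \<mu>
      show "\<zeta> b \<mu> = J (y b) \<mu>"
      proof (cases "\<mu> \<in> M")
        case True
        define \<nu> where "\<nu> = (\<Sum>a\<in>A. \<mu> a *\<^sub>R h a)"
        have \<nu>: "\<nu> \<in> M"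
          unfolding \<nu>_def using h by (intro subspace_sum subspace_scale subspace_M) auto
        have "(\<mu> - \<nu>) a = 0" if "a \<in> A" for a
        proof -
          have "\<nu> a = (\<Sum>a'\<in>A. if a' = a then \<mu> a' else 0)"
            unfolding \<nu>_def using h(2)[OF _ that]
            by (auto simp: blinfun.sum_left blinfun.scaleR_left intro!: sum.cong)
          then show ?thesis using that A by (simp add: blinfun.diff_left)
        qed
        then have "\<zeta> b (\<mu> - \<nu>) = 0"
          using True \<nu> by (intro \<zeta>_0 b subspace_diff subspace_M)
        then have "\<zeta> b \<mu> = \<zeta> b \<nu>"
          using subspace_dual_add[OF \<zeta>_dual, of "\<mu> - \<nu>" \<nu> b] True \<nu> subspace_diff[OF subspace_M]
          by simp
        also have "\<dots> = (\<Sum>a\<in>A. \<mu> a * \<zeta> b (h a))"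
          unfolding \<nu>_def by (intro subspace_dual_sum[OF subspace_M] \<zeta>_dual h)
        finally show ?thesis
          using True
          by (simp add: J_apply y_def blinfun.sum_right blinfun.scaleR_right mult.commute)
      next
        case False
        then show ?thesis
          using \<zeta>_dual[of b] by (simp add: J_apply subspace_dual_def)
      qed
    qed
    \<comment> \<open>\<open>U\<close> followed by the inverse of \<open>J\<close>: on the dual of
      \<open>M\<close> it takes values in \<open>span B\<close>, with norm at most
      \<open>L / c\<close>.\<close>
    define R where "R G = (THE x. J x = U G)" for G
    have R: "R G \<in> span B" "J (R G) = U G" if G: "G \<in> subspace_dual M" for G
    proof -
      obtain x where "x \<in> span B" "U G = J x"
        using U_range[OF G] by blast
      moreover from this have "R G = x"
        unfolding R_def by (intro the_equality) (auto simp: inj_J)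
      ultimately show "R G \<in> span B" "J (R G) = U G" by auto
    qed
    have R_sum: "R (\<Sum>f\<in>G. a f *\<^sub>R z f) = (\<Sum>f\<in>G. a f *\<^sub>R R (z f))" if "G \<subseteq> F" for a G
      using finite_subset[OF that F(1)] that
    proof (induction G)
      case empty
      have "0 \<in> subspace_dual M" by (rule subspace_0[OF subspace_subspace_dual])
      then have "J (R 0) = J 0"
        using R(2)[of 0] U_scale[of 0 0] linear_0[OF linear_J] by simp
      then show ?case by (simp only: sum.empty inj_J)
    next
      case (insert f G)
      let ?s = "\<Sum>f\<in>G. a f *\<^sub>R z f"
      have s: "?s \<in> subspace_dual M" and zf: "z f \<in> subspace_dual M"
        using insert.prems z(1)
        by (auto intro!: subspace_sum subspace_scale subspace_subspace_dual)
      then have azf: "a f *\<^sub>R z f \<in> subspace_dual M"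
        by (intro subspace_scale subspace_subspace_dual)
      have "J (R (a f *\<^sub>R z f + ?s)) = J (a f *\<^sub>R R (z f) + R ?s)"
        using R(2) s zf azf subspace_add[OF subspace_subspace_dual azf s]
        by (simp add: U_add U_scale linear_add[OF linear_J] linear_scale[OF linear_J])
      then have "R (a f *\<^sub>R z f + ?s) = a f *\<^sub>R R (z f) + R ?s"
        by (simp only: inj_J)
      moreover have "R ?s = (\<Sum>f\<in>G. a f *\<^sub>R R (z f))"
        using insert by simp
      ultimately show ?case
        by (simp only: sum.insert[OF insert.hyps])
    qed
    have R_norm: "norm (R G) \<le> L / c * subspace_dual_norm M G" if "G \<in> subspace_dual M" for G
    proof -
      have "c * norm (R G) \<le> L * subspace_dual_norm M G"
        using norm_le_norm_J[of "R G"] R(2)[OF that] U_norm[OF that] by simp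
      then show ?thesis using c_pos by (simp add: field_simps)
    qed
    have "Z (\<theta> m0) = (\<Sum>b\<in>B. \<zeta> b (m0 b))"
      by (intro Z_\<theta> m0_M)
    \<comment> \<open>Here \<open>U\<close> enters: it fixes \<open>J (y b)\<close>, so
      \<open>R (\<zeta> b) = y b\<close>, and on \<open>span A\<close> the functional
      \<open>m0 b\<close> may be replaced by \<open>g b\<close>.\<close>
    also have "\<dots> = (\<Sum>b\<in>B. g b (R (\<zeta> b)))"
    proof (intro sum.cong refl)
      fix b assume b: "b \<in> B"
      have "J (R (\<zeta> b)) = J (y b)"
        using R(2)[OF \<zeta>_dual[of b]] \<zeta>_J[OF b] U_id[OF y_span] by metis
      then have Ry: "R (\<zeta> b) = y b" by (simp add: inj_J)
      have "\<zeta> b (m0 b) = m0 b (y b)"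
        using \<zeta>_J[OF b] m0_M by (simp add: J_apply)
      also have "\<dots> = g b (\<Sum>a\<in>A. h a (y b) *\<^sub>R a)"
        by (simp add: m0_def blinfun.sum_left blinfun.sum_right blinfun.scaleR_left
            blinfun.scaleR_right mult.commute)
      also have "(\<Sum>a\<in>A. h a (y b) *\<^sub>R a) = y b"
        using biorthogonal_expansion[OF A(1) y_span h(2)] by simp
      finally show "\<zeta> b (m0 b) = g b (R (\<zeta> b))" by (simp add: Ry)
    qed
    also have "\<dots> = (\<Sum>b\<in>B. \<Sum>f\<in>F. blinfun_apply f b * g b (R (z f)))"
      unfolding \<zeta>_def R_sum[OF subset_refl] by (simp add: blinfun.sum_right blinfun.scaleR_right)
    also have "\<dots> = (\<Sum>f\<in>F. \<Sum>b\<in>B. blinfun_apply f b * g b (R (z f)))"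
      by (rule sum.swap)
    \<comment> \<open>Expanding \<open>R (z f)\<close> in the basis \<open>B\<close> collapses the
      trace, leaving terms bounded by the norms of the \<open>z f\<close>.\<close>
    also have "\<dots> = (\<Sum>f\<in>F. blinfun_apply f (R (z f)))"
    proof (intro sum.cong refl)
      fix f assume "f \<in> F"
      have "(\<Sum>b\<in>B. blinfun_apply f b * g b (R (z f))) = f (\<Sum>b\<in>B. g b (R (z f)) *\<^sub>R b)"
        by (simp add: blinfun.sum_right blinfun.scaleR_right mult.commute)
      then show "(\<Sum>b\<in>B. blinfun_apply f b * g b (R (z f))) = f (R (z f))"
        using biorthogonal_expansion[OF B(1) R(1)[OF z(1)[OF \<open>f \<in> F\<close>]] g(2)] by simp
    qed
    also have "\<dots> \<le> (\<Sum>f\<in>F. L / c * subspace_dual_norm M (z f))"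
    proof (intro sum_mono)
      fix f assume f: "f \<in> F"
      have "f (R (z f)) \<le> norm f * norm (R (z f))"
        using norm_blinfun[of f "R (z f)"] by simp
      also have "\<dots> \<le> norm (R (z f))"
        using F(4)[OF f] by (simp add: mult_left_le_one_le)
      also have "\<dots> \<le> L / c * subspace_dual_norm M (z f)"
        by (intro R_norm z f)
      finally show "f (R (z f)) \<le> L / c * subspace_dual_norm M (z f)" .
    qed
    also have "\<dots> = L / c * (\<Sum>f\<in>F. subspace_dual_norm M (z f))"
      by (simp add: sum_distrib_left)
    also have "\<dots> \<le> L / c"
      using mult_left_mono[OF z(3), of "L / c"] L c_pos by simp
    finally show False using Z(4) by simp
  qed
  then obtain k where k: "k \<in> D" "p (\<theta> m0 + \<theta> k) < L / c + 1"
    by blast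
  define m where "m b = m0 b + k b" for b
  have \<theta>m: "p (\<theta> m) < L / c + 1"
  proof -
    have "m = m0 + k" by (simp add: m_def fun_eq_iff)
    then show ?thesis using k(2) linear_add[OF lin_\<theta>, of m0 k] by simp
  qed
  have m_M: "m b \<in> M" for b
    using k(1) m0_M subspace_add[OF subspace_M] by (auto simp: m_def D_def)
  define w where "w = sum_op B m (\<lambda>b. b)"
  have w_\<theta>: "f o\<^sub>L w = \<theta> m f" for f
    by (simp add: w_def compose_sum_op \<theta>_def)
  have w_range: "w x \<in> span B" for x
    by (auto simp: w_def intro!: span_sum intro: span_scale span_base)
  have w_A: "w a = a" if "a \<in> A" for a
  proof -
    have "w a = (\<Sum>b\<in>B. g b a *\<^sub>R b)"
      using k(1) that by (simp add: w_def m_def D_def blinfun.add_left m0_A)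
    then show ?thesis
      using biorthogonal_expansion[OF B(1) _ g(2), of a] AB that by auto
  qed
  show thesis
  proof (rule that[of w])
    show "range w \<subseteq> span B" using w_range by blast
    show "w x = x" if "x \<in> span A" for x
      using that
    proof (induction rule: span_induct_alt)
      case (step r a x)
      then show ?case by (simp add: blinfun.add_right blinfun.scaleR_right w_A)
    qed simp
    show "f o\<^sub>L w \<in> M" for f :: "'a \<Rightarrow>\<^sub>L real"
      unfolding w_\<theta> by (intro \<theta>_M m_M)
    show "norm w \<le> 2 / c * (L / c + 1)"
    proof (rule norm_blinfun_bound)
      show pos: "0 \<le> 2 / c * (L / c + 1)" using L c_pos by simp
      fix x
      show "norm (w x) \<le> 2 / c * (L / c + 1) * norm x"
      proof (cases "w x = 0")
        case False
        \<comment> \<open>One \<open>f\<close> in \<open>F\<close> norms \<open>w x\<close> up to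
          \<open>c / 2\<close>, and \<open>f o\<^sub>L w\<close> is \<open>\<theta> m f\<close>,
          whose norm is below \<open>L / c + 1\<close>.\<close>
        then obtain f where f: "f \<in> F" "c / 2 * norm (w x) < f (w x)"
          using F(5) w_range by blast
        have "f (w x) = \<theta> m f x"
          using w_\<theta>[of f] by (metis blinfun_apply_blinfun_compose)
        also have "\<dots> \<le> norm (\<theta> m f) * norm x"
          using norm_blinfun[of "\<theta> m f" x] by simp
        also have "\<dots> \<le> (L / c + 1) * norm x"
          using p_ge[OF f(1), of "\<theta> m"] \<theta>m by (intro mult_right_mono) auto
        finally have "2 / c * f (w x) \<le> 2 / c * ((L / c + 1) * norm x)"
          using c_pos by (intro mult_left_mono) auto
        moreover have "norm (w x) \<le> 2 / c * f (w x)"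
          using f(2) c_pos by (simp add: field_simps)
        ultimately show ?thesis by (simp only: mult.assoc)
      next
        case True
        then show ?thesis using mult_nonneg_nonneg[OF pos norm_ge_zero[of x]] by simp
      qed
    qed
  qed
qed

text \<open>The norm bound involves only \<open>l\<close> and \<open>c\<close>, not the pair, so
  uniform approximability carries over.\<close>

lemma approximable_dualD:
  assumes app: "approximable (subspace_dual M) (subspace_dual_norm M) l (J ` X1) (J ` X2)"
    and "l \<ge> 0" and X1: "finite_dim_subspace X1" and X2: "finite_dim_subspace X2" and "X1 \<subseteq> X2"
  obtains w where "range (blinfun_apply w) \<subseteq> X2" "\<And>x. x \<in> X1 \<Longrightarrow> blinfun_apply w x = x"
    "\<And>f :: 'a \<Rightarrow>\<^sub>L real. f o\<^sub>L w \<in> M" "norm w \<le> 2 / c * (l / c + 1)"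
proof -
  obtain A where A: "finite A" "independent A" "span A = X1"
    using finite_dim_subspace_basis[OF X1] .
  obtain B where B: "finite B" "independent B" "span B = X2"
    using finite_dim_subspace_basis[OF X2] .
  have AB: "A \<subseteq> span B"
    using A B \<open>X1 \<subseteq> X2\<close> span_superset by blast
  from app obtain U where U: "\<forall>x\<in>subspace_dual M. \<forall>y\<in>subspace_dual M. U (x + y) = U x + U y"
    "\<forall>r. \<forall>x\<in>subspace_dual M. U (r *\<^sub>R x) = r *\<^sub>R U x"
    "U ` subspace_dual M \<subseteq> J ` X2"
    "\<forall>x\<in>subspace_dual M. subspace_dual_norm M (U x) \<le> l * subspace_dual_norm M x"
    "\<forall>x\<in>J ` X1. U x = x"
    unfolding approximable_def by (elim conjE exE) (rule that)
  show thesis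
  proof (rule factor_through_M[OF A(1,2) B(1,2) AB \<open>l \<ge> 0\<close>, of U])
    show "U G \<in> J ` span B" if "G \<in> subspace_dual M" for G
      using U(3) that B(3) by blast
    show "U (J x) = J x" if "x \<in> span A" for x
      using U(5) that A(3) by blast
  next
    fix w
    assume w: "range (blinfun_apply w) \<subseteq> span B" "\<And>x. x \<in> span A \<Longrightarrow> blinfun_apply w x = x"
      "\<And>f :: 'a \<Rightarrow>\<^sub>L real. f o\<^sub>L w \<in> M" "norm w \<le> 2 / c * (l / c + 1)"
    show thesis
    proof (rule that)
      show "range w \<subseteq> X2" using w(1) B(3) by simp
      show "w x = x" if "x \<in> X1" for x using w(2) A(3) that by simp
    qed (rule w)+
  qed (use U(1,2,4) in simp_all)
qed

section \<open>Producing approximable pairs\<close>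

text \<open>An operator that is within \<open>1 / K\<close> of the identity on a basis is corrected
  to be exact there, adding at most 1 to its norm. \<open>E2\<close> contains the basis and the
  range of \<open>T\<close>, hence also the corrections \<open>a - T a\<close>.\<close>

lemma bounded_approximation_imp_approximable:
  fixes E :: "'a set"
  assumes E: "finite_dim_subspace E"
    and bap: "\<And>K e. compact K \<Longrightarrow> e > 0 \<Longrightarrow> \<exists>T :: 'a \<Rightarrow>\<^sub>L 'a.
      finite_rank T \<and> norm T \<le> l \<and> (\<forall>x\<in>K. norm (blinfun_apply T x - x) \<le> e)"
    and "l > 0"
  obtains E2 where "approximable UNIV norm (l + 1) E E2"
proof -
  obtain A where A: "finite A" "independent A" "span A = E"
    using finite_dim_subspace_basis[OF E] .
  obtain K where K: "K > 0"
    "\<And>(T :: 'a \<Rightarrow>\<^sub>L 'a) e. e \<ge> 0 \<Longrightarrow> (\<And>a. a \<in> A \<Longrightarrow> norm (blinfun_apply T a - a) \<le> e) \<Longrightarrow>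
      \<exists>T'. (\<forall>x\<in>span A. blinfun_apply T' x = x) \<and> norm T' \<le> norm T + K * e \<and>
        (\<forall>x. blinfun_apply T' x - blinfun_apply T x \<in> span ((\<lambda>a. a - blinfun_apply T a) ` A)) \<and>
        (\<forall>f :: 'a \<Rightarrow>\<^sub>L real. f o\<^sub>L T \<in> M \<longrightarrow> f o\<^sub>L T' \<in> M)"
    using correct_to_identity[OF A(1,2)] by blast
  obtain T :: "'a \<Rightarrow>\<^sub>L 'a" where T: "finite_rank T" "norm T \<le> l"
    "\<And>a. a \<in> A \<Longrightarrow> norm (T a - a) \<le> 1 / K"
    using bap[OF finite_imp_compact[OF A(1)], of "1 / K"] K(1) by auto
  obtain T' where T': "\<And>x. x \<in> span A \<Longrightarrow> blinfun_apply T' x = x" "norm T' \<le> norm T + K * (1 / K)"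
    "\<And>x. blinfun_apply T' x - blinfun_apply T x \<in> span ((\<lambda>a. a - blinfun_apply T a) ` A)"
    using K(2)[of "1 / K" T] T(3) K(1) by auto
  obtain B where B: "finite B" "span B = range T"
    using T(1) unfolding finite_rank_def finite_dim_subspace_def by blast
  define E2 where "E2 = span (A \<union> B)"
  have T_E2: "T x \<in> E2" for x
    using B(2) span_mono[of B "A \<union> B"] unfolding E2_def by blast
  have "span ((\<lambda>a. a - T a) ` A) \<subseteq> E2"
    unfolding E2_def
  proof (rule span_minimal[OF _ subspace_span])
    show "(\<lambda>a. a - T a) ` A \<subseteq> span (A \<union> B)"
      using T_E2 unfolding E2_def by (auto intro: span_diff span_base)
  qed
  then have "T' x - T x + T x \<in> E2" for x
    using T'(3)[of x] T_E2[of x] unfolding E2_def by (blast intro: span_add)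
  then have "range T' \<subseteq> E2" by auto
  moreover have "norm T' \<le> l + 1" using T'(2) T(2) K(1) by simp
  moreover have "finite_dim_subspace E2"
    unfolding finite_dim_subspace_def E2_def using A B by blast
  moreover have "E \<subseteq> E2"
    unfolding E2_def A(3)[symmetric] by (intro span_mono) auto
  ultimately have "approximable UNIV norm (l + 1) E E2"
    using E T'(1) A(3) \<open>l > 0\<close> by (subst approximable_UNIV_iff) auto
  then show thesis by (rule that)
qed

text \<open>The composite of \<open>u\<close> and \<open>v n\<close> has norm at most
  \<open>l * K\<close>, and correcting it on a basis of \<open>X1\<close> costs 1. The index
  \<open>n\<close> depends on the pair, the constant does not.\<close>

lemma approximable_imp_approximable_dual:
  assumes app: "approximable UNIV norm l X1 X2" and "l > 0"
    and v: "\<And>x. (\<lambda>n. norm (blinfun_apply (v n) x - x)) \<longlonglongrightarrow> 0"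
      "\<And>n. range (blinfun_apply (adjoint_op (v n))) \<subseteq> M" "\<And>n. norm (v n) \<le> K"
  shows "approximable (subspace_dual M) (subspace_dual_norm M) (l * K + 1) (J ` X1) (J ` X2)"
proof -
  obtain u :: "'a \<Rightarrow>\<^sub>L 'a" where X: "finite_dim_subspace X1" "finite_dim_subspace X2" "X1 \<subseteq> X2"
    and u: "range u \<subseteq> X2" "norm u \<le> l" "\<forall>x\<in>X1. u x = x"
    using app unfolding approximable_UNIV_iff[OF \<open>l > 0\<close>] by blast
  obtain A where A: "finite A" "independent A" "span A = X1"
    using finite_dim_subspace_basis[OF X(1)] .
  have X2: "subspace X2"
    using X(2) unfolding finite_dim_subspace_def by auto
  obtain C where C: "C > 0"
    "\<And>(T :: 'a \<Rightarrow>\<^sub>L 'a) e. e \<ge> 0 \<Longrightarrow> (\<And>a. a \<in> A \<Longrightarrow> norm (blinfun_apply T a - a) \<le> e) \<Longrightarrow>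
      \<exists>T'. (\<forall>x\<in>span A. blinfun_apply T' x = x) \<and> norm T' \<le> norm T + C * e \<and>
        (\<forall>x. blinfun_apply T' x - blinfun_apply T x \<in> span ((\<lambda>a. a - blinfun_apply T a) ` A)) \<and>
        (\<forall>f :: 'a \<Rightarrow>\<^sub>L real. f o\<^sub>L T \<in> M \<longrightarrow> f o\<^sub>L T' \<in> M)"
    using correct_to_identity[OF A(1,2)] by blast
  have "\<forall>\<^sub>F n in sequentially. \<forall>a\<in>A. norm ((u o\<^sub>L v n) a - a) \<le> 1 / C"
  proof (rule eventually_ball_finite[OF A(1)], rule ballI)
    fix a assume "a \<in> A"
    then have ua: "u a = a" using u(3) A(3) span_base by blast
    have "(\<lambda>n. v n a) \<longlonglongrightarrow> a"
      using v(1)[of a] by (simp add: LIM_zero_iff tendsto_norm_zero_iff)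
    then have "(\<lambda>n. u (v n a)) \<longlonglongrightarrow> u a"
      by (intro blinfun.tendsto tendsto_const)
    then show "\<forall>\<^sub>F n in sequentially. norm ((u o\<^sub>L v n) a - a) \<le> 1 / C"
      using C(1) unfolding ua tendsto_iff dist_norm
      by (auto elim!: allE[of _ "1 / C"] eventually_mono)
  qed
  then obtain n where n: "\<And>a. a \<in> A \<Longrightarrow> norm ((u o\<^sub>L v n) a - a) \<le> 1 / C"
    unfolding eventually_sequentially by blast
  obtain w where w: "\<And>x. x \<in> span A \<Longrightarrow> blinfun_apply w x = x"
    "norm w \<le> norm (u o\<^sub>L v n) + C * (1 / C)"
    "\<And>x. blinfun_apply w x - (u o\<^sub>L v n) x \<in> span ((\<lambda>a. a - (u o\<^sub>L v n) a) ` A)"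
    "\<And>f :: 'a \<Rightarrow>\<^sub>L real. f o\<^sub>L (u o\<^sub>L v n) \<in> M \<Longrightarrow> f o\<^sub>L w \<in> M"
    using C(2)[of "1 / C" "u o\<^sub>L v n"] n C(1) by auto
  show ?thesis
  proof (rule approximable_dualI[OF X, of w])
    have "A \<subseteq> X2" using A X(3) span_superset by blast
    then have "span ((\<lambda>a. a - (u o\<^sub>L v n) a) ` A) \<subseteq> X2"
      using u(1) by (intro span_minimal X2) (auto intro!: subspace_diff[OF X2])
    then have "w x - (u o\<^sub>L v n) x + (u o\<^sub>L v n) x \<in> X2" for x
      using w(3)[of x] u(1) by (intro subspace_add[OF X2]) auto
    then show "range w \<subseteq> X2" by auto
    show "w x = x" if "x \<in> X1" for x using w(1) A(3) that by simp
    have "norm (u o\<^sub>L v n) \<le> norm u * norm (v n)" by (rule norm_blinfun_compose)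
    also have "\<dots> \<le> l * K"
      using u(2) v(3)[of n] \<open>l > 0\<close> by (intro mult_mono) auto
    finally show "norm w \<le> l * K + 1" using w(2) C(1) by simp
    fix f :: "'a \<Rightarrow>\<^sub>L real"
    \<comment> \<open>Applying \<open>v n\<close> first matters: the adjoint of \<open>v n\<close>
      is then the last to act, so the result lies in \<open>M\<close>.\<close>
    have "f o\<^sub>L (u o\<^sub>L v n) = adjoint_op (v n) (f o\<^sub>L u)"
      by (intro blinfun_eqI) (simp add: adjoint_op.rep_eq)
    then show "f o\<^sub>L w \<in> M"
      using v(2)[of n] by (intro w(4)) auto
  qed
qed

end

section \<open>The characterization\<close>

text \<open>Each \<open>d j\<close> is eventually fixed, and the uniform norm bound extends
  convergence from the dense range of \<open>d\<close> to every \<open>x\<close>.\<close>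

lemma approximating_sequence_converges:
  fixes w :: "nat \<Rightarrow> 'a::real_normed_vector \<Rightarrow>\<^sub>L 'a"
  assumes dense: "closure (range d) = UNIV"
    and id: "\<And>i j. j \<le> i \<Longrightarrow> w i (d j) = d j" and C: "\<And>i. norm (w i) \<le> C"
  shows "(\<lambda>n. norm (w n x - x)) \<longlonglongrightarrow> 0"
proof -
  have "C \<ge> 0" using C[of 0] norm_ge_zero order_trans by blast
  have "\<exists>N. \<forall>n\<ge>N. norm (norm (w n x - x) - 0) < e" if "e > 0" for e
  proof -
    \<comment> \<open>The error at \<open>x\<close> is at most \<open>C + 1\<close> times the
      distance from \<open>x\<close> to \<open>d j\<close>.\<close>
    have "e / (C + 1) > 0" using that \<open>C \<ge> 0\<close> by simp
    then obtain j where j: "dist (d j) x < e / (C + 1)"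
      using dense closure_approachable[of x "range d"] by auto
    have "norm (w n x - x) < e" if "n \<ge> j" for n
    proof -
      have "w n x - x = w n (x - d j) - (x - d j)"
        using id[OF that] by (simp add: blinfun.diff_right)
      then have "norm (w n x - x) \<le> norm (w n (x - d j)) + norm (x - d j)"
        by (simp only: norm_triangle_ineq4)
      also have "\<dots> \<le> C * norm (x - d j) + norm (x - d j)"
        using norm_blinfun[of "w n" "x - d j"] mult_right_mono[OF C[of n], of "norm (x - d j)"]
        by simp
      also have "\<dots> < e"
        using j \<open>C \<ge> 0\<close> by (simp add: dist_norm norm_minus_commute field_simps)
      finally show ?thesis .
    qed
    then show ?thesis by auto
  qed
  then show ?thesis by (simp add: LIMSEQ_iff)
qed

theorem theorem2:
  fixes M :: "('a::banach \<Rightarrow>\<^sub>L real) set"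
  assumes "separable_space (euclidean :: 'a topology)"
    and "bounded_approximation_property TYPE('a)"
    and "subspace M"
    and "norming M"
  shows "quasibasic M \<longleftrightarrow>
    (\<forall>X1 X2 :: nat \<Rightarrow> 'a set.
      uniformly_approximable UNIV norm X1 X2 \<longrightarrow>
      uniformly_approximable (subspace_dual M) (subspace_dual_norm M)
        (\<lambda>i. quotient_map_dual M ` canonical_embedding ` X1 i)
        (\<lambda>i. quotient_map_dual M ` canonical_embedding ` X2 i))"
proof -
  obtain c where c: "c > 0" "\<And>x. c * norm x \<le> (SUP f\<in>M. \<bar>blinfun_apply f x\<bar> / norm f)"
    using assms(4) unfolding norming_def by auto
  interpret norming_subspace M c
    using assms(3) c by unfold_locales
  have J: "quotient_map_dual M ` canonical_embedding ` X = J ` X" for X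
    by (simp add: J_def image_image)
  show ?thesis
    unfolding J
  proof (intro iffI allI impI)
    fix X1 X2 :: "nat \<Rightarrow> 'a set"
    assume "quasibasic M" "uniformly_approximable UNIV norm X1 X2"
    then obtain v l where
      v: "\<And>x. (\<lambda>n. norm (blinfun_apply (v n) x - x)) \<longlonglongrightarrow> 0"
        "\<And>n. range (blinfun_apply (adjoint_op (v n))) \<subseteq> M"
      and l: "l > 0" "\<And>i. approximable UNIV norm l (X1 i) (X2 i)"
      unfolding quasibasic_def uniformly_approximable_def by auto
    \<comment> \<open>Convergent sequences are bounded, so completeness gives one bound for all
      \<open>v n\<close>.\<close>
    have "\<exists>K. \<forall>n. norm (v n x) \<le> K" for x
    proof -
      have "(\<lambda>n. v n x) \<longlonglongrightarrow> x"
        using v(1)[of x] by (simp add: LIM_zero_iff tendsto_norm_zero_iff)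
      then show ?thesis
        using convergent_imp_Bseq[of "\<lambda>n. v n x"] unfolding convergent_def Bseq_def by blast
    qed
    then obtain K where K: "K > 0" "\<And>n. norm (v n) \<le> K"
      using uniform_boundedness[of v] by blast
    have "l * K + 1 > 0" using l(1) K(1) by (simp add: add_pos_pos)
    then show "uniformly_approximable (subspace_dual M) (subspace_dual_norm M)
        (\<lambda>i. J ` X1 i) (\<lambda>i. J ` X2 i)"
      unfolding uniformly_approximable_def
      using approximable_imp_approximable_dual[OF l(2) l(1) v K(2)] by blast
  next
    assume hyp: "\<forall>X1 X2 :: nat \<Rightarrow> 'a set. uniformly_approximable UNIV norm X1 X2 \<longrightarrow>
      uniformly_approximable (subspace_dual M) (subspace_dual_norm M)
        (\<lambda>i. J ` X1 i) (\<lambda>i. J ` X2 i)"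
    obtain D :: "'a set" where D: "countable D" "closure D = UNIV"
      using assms(1) unfolding separable_space_def by (auto simp: euclidean_closure_of)
    have "D \<noteq> {}" using D(2) by auto
    define d where "d = from_nat_into D"
    have "range d = D"
      unfolding d_def using \<open>D \<noteq> {}\<close> D(1) by (rule range_from_nat_into)
    \<comment> \<open>Increasing spans of initial segments of a dense sequence: an operator fixing
      \<open>E i\<close> fixes every \<open>d j\<close> with \<open>j \<le> i\<close>.\<close>
    define E where "E i = span (d ` {..i})" for i
    have E: "finite_dim_subspace (E i)" for i
      unfolding finite_dim_subspace_def E_def by blast
    obtain l where l: "l > 0" "\<And>K e. compact K \<Longrightarrow> e > 0 \<Longrightarrow> \<exists>T :: 'a \<Rightarrow>\<^sub>L 'a.
        finite_rank T \<and> norm T \<le> l \<and> (\<forall>x\<in>K. norm (blinfun_apply T x - x) \<le> e)"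
      using assms(2) unfolding bounded_approximation_property_def by metis
    have "\<exists>E2. approximable UNIV norm (l + 1) (E i) E2" for i
      by (rule bounded_approximation_imp_approximable[OF E, of l i]) (use l in auto)
    then obtain E2 where E2: "\<And>i. approximable UNIV norm (l + 1) (E i) (E2 i)"
      by metis
    have "uniformly_approximable UNIV norm E E2"
      unfolding uniformly_approximable_def using E2 l(1) by (auto intro!: exI[of _ "l + 1"])
    \<comment> \<open>The hypothesis is needed for this one sequence of pairs only; \<open>k\<close>
      is common to all indices.\<close>
    then obtain k where k: "k > 0"
      "\<And>i. approximable (subspace_dual M) (subspace_dual_norm M) k (J ` E i) (J ` E2 i)"
      using hyp unfolding uniformly_approximable_def by blast
    have E2': "finite_dim_subspace (E2 i)" "E i \<subseteq> E2 i" for i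
      using E2[of i] unfolding approximable_def by blast+
    have "\<exists>w. range (blinfun_apply w) \<subseteq> E2 i \<and> (\<forall>x\<in>E i. blinfun_apply w x = x) \<and>
        (\<forall>f :: 'a \<Rightarrow>\<^sub>L real. f o\<^sub>L w \<in> M) \<and> norm w \<le> 2 / c * (k / c + 1)" for i
      using approximable_dualD[OF k(2) _ E E2'] k(1) by (metis less_imp_le)
    then obtain w where w: "\<And>i. range (blinfun_apply (w i)) \<subseteq> E2 i"
      "\<And>i x. x \<in> E i \<Longrightarrow> blinfun_apply (w i) x = x"
      "\<And>i (f :: 'a \<Rightarrow>\<^sub>L real). f o\<^sub>L w i \<in> M" "\<And>i. norm (w i) \<le> 2 / c * (k / c + 1)"
      by metis
    have "finite_rank (w i)" for i
      using E2'(1)[of i] w(1)[of i] finite_rankI unfolding finite_dim_subspace_def by blast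
    moreover have "(\<lambda>n. norm (w n x - x)) \<longlonglongrightarrow> 0" for x
    proof (rule approximating_sequence_converges[where d = d])
      show "closure (range d) = UNIV" using D(2) \<open>range d = D\<close> by simp
      show "w i (d j) = d j" if "j \<le> i" for i j
        using that by (intro w(2)) (auto simp: E_def intro: span_base)
    qed (rule w(4))
    moreover have "range (adjoint_op (w n)) \<subseteq> M" for n
      using w(3) by (auto simp: adjoint_op.rep_eq)
    ultimately show "quasibasic M"
      unfolding quasibasic_def using subspace_M by blast
  qed
qed

end
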